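(* Let $2\le m<n$ be integers and let $E=K(n,m,\mathcal D)\in\mathcal M_{t,v,d}(n,m)$. Let $a_1^*>\cdots>a_{\tilde p}^*$ be the distinct non-zero terms of the distribution sequence of $\mathcal D$, let $M_0$ be an integer such that for all $k\ge1$ each connected component of $\widetilde{\mathbf E}_k$ consists of at most $M_0$ basic rectangles of rank $k$, and put $L_0=(m-1)M_0$. (i) For every $k\ge1$, every component $U$ of $\mathbf E_k$ and every member $B$ of $U$, $$\frac{\mu_E(U)}{\mu_E(B)}\in\frac{\mathbb Z\cap(0,L_0n^{2m})}{(a_1^*\cdots a_{\tilde p}^* )^2},$$ i.e. the ratio equals $u/(a_1^*\cdots a_{\tilde p}^* )^2$ for some integer $u$ with $0<u<L_0n^{2m}$. (ii) There exists a positive integer $H$ such that for every $k\ge1$, every component $U$ of $\mathbf E_k$ and every direct offspring $U'$ of $U$, $$\frac{\mu_E(U')}{\mu_E(U)}\in\frac{\mathbb Z}{H}.$$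
   Context: For integers $2\le m<n$ and a non-empty digit set $\mathcal D\subset\{0,1,\dots,n-1\}\times\{0,1,\dots,m-1\}$, let $S_d(z)=\mathrm{diag}(n^{-1},m^{-1})(z+d)$, $d\in\mathcal D$. The self-affine carpet $E=K(n,m,\mathcal D)$ is the unique non-empty compact set with $E=\bigcup_{d\in\mathcal D}S_d(E)$. The distribution sequence of $\mathcal D$ is $(a_j)_{j=0}^{m-1}$, $a_j=\#\{i:(i,j)\in\mathcal D\}$; put $\mathcal E=\{j:a_j>0\}$. The $j$-th row is vacant if $a_j=0$. The uniform Bernoulli measure $\mu_E$ is the unique Borel probability measure on $E$ satisfying $\mu_E=\sum_{d\in\mathcal D}\frac{1}{\#\mathcal D}\,\mu_E\circ S_d^{-1}$ (regarded as a measure on $\mathbb R^2$). For $\mathbf i=d_1\cdots d_k\in\mathcal D^k$, with $S_{\mathbf i}=S_{d_1}\circ\cdots\circ S_{d_k}$, the set $S_{\mathbf i}([0,1]^2)$ is a basic rectangle of rank $k$, and $\widetilde{\mathbf E}_k=\bigcup_{\mathbf i\in\mathcal D^k}S_{\mathbf i}([0,1]^2)$. A constant $M_0$ as in the claim exists whenever $E$ is totally disconnected (known result of Miao, Xi and Xiong). Let $\sigma=\log m/\log n$, $\ell(k)=\lfloor k/\sigma\rfloor$, and $0.x_1\dots x_k|_q=\sum_{j=1}^kx_jq^{-j}$. For $\mathbf x=x_1\dots x_k\in\{0,\dots,n-1\}^k$ and $\mathbf y=y_1\dots y_{\ell(k)}\in\{0,\dots,m-1\}^{\ell(k)}$ put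 $Q(\mathbf x,\mathbf y)=(0.\mathbf x|_n,0.\mathbf y|_m)+[0,n^{-k}]\times[0,m^{-\ell(k)}]$; it is an approximate square of rank $k$ if $(x_j,y_j)\in\mathcal D$ for $1\le j\le k$ and $y_j\in\mathcal E$ for $k<j\le\ell(k)$. $\mathbf E_k$ is the union of all approximate squares of rank $k$. A component of $\mathbf E_k$ is a connected component of $\mathbf E_k$; its members are the approximate squares of rank $k$ contained in it. A direct offspring of a component $U$ of $\mathbf E_k$ is a component $U'$ of $\mathbf E_{k+1}$ with $U'\subset U$. A measure $\mu$ on a metric space $X$ is doubling if there is $C\ge1$ such that $0<\mu(B(x,2r))\le C\mu(B(x,r))<\infty$ for all balls $B(x,r)\subset X$ of radius $r$. $\mathcal M_{t,v,d}(n,m)$ is the set of self-affine carpets $E=K(n,m,\mathcal D)$ that are totally disconnected, possess vacant rows (at least one $j\in\{0,\dots,m-1\}$ with $a_j=0$), and whose uniform Bernoulli measure $\mu_E$ is doubling (as a measure on $E$). *)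

theory Defs
  imports "HOL-Analysis.Analysis"
begin

definition digit_set :: "nat \<Rightarrow> nat \<Rightarrow> (nat \<times> nat) set \<Rightarrow> bool" where
  "digit_set n m D \<longleftrightarrow> D \<noteq> {} \<and> D \<subseteq> {0..<n} \<times> {0..<m}"

definition S_map :: "nat \<Rightarrow> nat \<Rightarrow> nat \<times> nat \<Rightarrow> real \<times> real \<Rightarrow> real \<times> real" where
  "S_map n m d z = ((fst z + real (fst d)) / real n, (snd z + real (snd d)) / real m)"

text \<open>The carpet and its uniform Bernoulli measure are each determined uniquely by the
  conditions below. They are introduced through these conditions, so that a statement about all
  \<open>E\<close> and \<open>\<mu>\<close> satisfying them is a statement about the carpet and its measure.\<close>

definition is_carpet :: "nat \<Rightarrow> nat \<Rightarrow> (nat \<times> nat) set \<Rightarrow> (real \<times> real) set \<Rightarrow> bool" where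
  "is_carpet n m D E \<longleftrightarrow> E \<noteq> {} \<and> compact E \<and> E = (\<Union>d\<in>D. S_map n m d ` E)"

definition is_uniform_bernoulli ::
    "nat \<Rightarrow> nat \<Rightarrow> (nat \<times> nat) set \<Rightarrow> (real \<times> real) set \<Rightarrow> (real \<times> real) measure \<Rightarrow> bool" where
  "is_uniform_bernoulli n m D E \<mu> \<longleftrightarrow>
     sets \<mu> = sets borel \<and> emeasure \<mu> UNIV = 1 \<and> emeasure \<mu> E = 1 \<and>
     (\<forall>A\<in>sets borel. measure \<mu> A = (\<Sum>d\<in>D. 1 / real (card D) * measure \<mu> (S_map n m d -` A)))"

definition row_count :: "(nat \<times> nat) set \<Rightarrow> nat \<Rightarrow> nat" where
  "row_count D j = card {i. (i, j) \<in> D}"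

definition nonvacant_rows :: "nat \<Rightarrow> (nat \<times> nat) set \<Rightarrow> nat set" where
  "nonvacant_rows m D = {j\<in>{0..<m}. row_count D j > 0}"

definition distinct_nonzero_terms :: "nat \<Rightarrow> (nat \<times> nat) set \<Rightarrow> nat set" where
  "distinct_nonzero_terms m D = row_count D ` {0..<m} - {0}"

definition totally_disconnected :: "'a::topological_space set \<Rightarrow> bool" where
  "totally_disconnected X \<longleftrightarrow> (\<forall>C\<in>components X. \<exists>x. C = {x})"

text \<open>The balls of the metric subspace \<open>X\<close> are the traces on \<open>X\<close> of the ambient balls centred
  in \<open>X\<close>.\<close>

definition doubling_on :: "'a::metric_space set \<Rightarrow> 'a measure \<Rightarrow> bool" where
  "doubling_on X \<mu> \<longleftrightarrow>
     (\<exists>C::real. C \<ge> 1 \<and>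
       (\<forall>x\<in>X. \<forall>r>0.
          0 < emeasure \<mu> (X \<inter> ball x (2 * r)) \<and>
          emeasure \<mu> (X \<inter> ball x (2 * r)) \<le> ennreal C * emeasure \<mu> (X \<inter> ball x r) \<and>
          ennreal C * emeasure \<mu> (X \<inter> ball x r) < \<infinity>))"

text \<open>Membership of the carpet \<open>E\<close>, presented by its digit set \<open>D\<close> and its uniform Bernoulli
  measure \<open>\<mu>\<close>, in the class of totally disconnected carpets with vacant rows and doubling
  uniform Bernoulli measure.\<close>

definition in_Mtvd ::
    "nat \<Rightarrow> nat \<Rightarrow> (nat \<times> nat) set \<Rightarrow> (real \<times> real) set \<Rightarrow> (real \<times> real) measure \<Rightarrow> bool" where
  "in_Mtvd n m D E \<mu> \<longleftrightarrow>
     digit_set n m D \<and> is_carpet n m D E \<and> is_uniform_bernoulli n m D E \<mu> \<and>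
     totally_disconnected E \<and> (\<exists>j\<in>{0..<m}. row_count D j = 0) \<and> doubling_on E \<mu>"

definition S_word :: "nat \<Rightarrow> nat \<Rightarrow> (nat \<times> nat) list \<Rightarrow> real \<times> real \<Rightarrow> real \<times> real" where
  "S_word n m ds = foldr (\<lambda>d f. S_map n m d \<circ> f) ds id"

definition basic_rectangles ::
    "nat \<Rightarrow> nat \<Rightarrow> (nat \<times> nat) set \<Rightarrow> nat \<Rightarrow> (real \<times> real) set set" where
  "basic_rectangles n m D k =
     {S_word n m ds ` ({0..1} \<times> {0..1}) | ds. length ds = k \<and> set ds \<subseteq> D}"

definition E_tilde :: "nat \<Rightarrow> nat \<Rightarrow> (nat \<times> nat) set \<Rightarrow> nat \<Rightarrow> (real \<times> real) set" where
  "E_tilde n m D k = \<Union>(basic_rectangles n m D k)"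

definition sigma :: "nat \<Rightarrow> nat \<Rightarrow> real" where
  "sigma n m = ln (real m) / ln (real n)"

definition ell :: "nat \<Rightarrow> nat \<Rightarrow> nat \<Rightarrow> nat" where
  "ell n m k = nat \<lfloor>real k / sigma n m\<rfloor>"

text \<open>Words are lists, so the digit written with index \<open>j\<close> (starting at \<open>1\<close>) is
  \<open>xs ! (j - 1)\<close>; below, \<open>j\<close> is the list position.\<close>

definition expansion :: "nat \<Rightarrow> nat list \<Rightarrow> real" where
  "expansion q xs = (\<Sum>j<length xs. real (xs ! j) / real q ^ (j + 1))"

definition Q_set :: "nat \<Rightarrow> nat \<Rightarrow> nat list \<Rightarrow> nat list \<Rightarrow> (real \<times> real) set" where
  "Q_set n m x y =
     {expansion n x .. expansion n x + 1 / real n ^ length x} \<times>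
     {expansion m y .. expansion m y + 1 / real m ^ length y}"

definition approx_squares ::
    "nat \<Rightarrow> nat \<Rightarrow> (nat \<times> nat) set \<Rightarrow> nat \<Rightarrow> (real \<times> real) set set" where
  "approx_squares n m D k =
     {Q_set n m x y | x y.
        length x = k \<and> set x \<subseteq> {0..<n} \<and> length y = ell n m k \<and> set y \<subseteq> {0..<m} \<and>
        (\<forall>j<k. (x ! j, y ! j) \<in> D) \<and>
        (\<forall>j. k \<le> j \<and> j < ell n m k \<longrightarrow> y ! j \<in> nonvacant_rows m D)}"

definition E_approx :: "nat \<Rightarrow> nat \<Rightarrow> (nat \<times> nat) set \<Rightarrow> nat \<Rightarrow> (real \<times> real) set" where
  "E_approx n m D k = \<Union>(approx_squares n m D k)"

definition members ::
    "nat \<Rightarrow> nat \<Rightarrow> (nat \<times> nat) set \<Rightarrow> nat \<Rightarrow> (real \<times> real) set \<Rightarrow> (real \<times> real) set set" where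
  "members n m D k U = {B \<in> approx_squares n m D k. B \<subseteq> U}"

definition direct_offspring ::
    "nat \<Rightarrow> nat \<Rightarrow> (nat \<times> nat) set \<Rightarrow> nat \<Rightarrow> (real \<times> real) set \<Rightarrow> (real \<times> real) set set" where
  "direct_offspring n m D k U = {U' \<in> components (E_approx n m D (Suc k)). U' \<subseteq> U}"

end

theory Submission
  imports Defs
begin

text \<open>
  Both parts of the theorem come from an explicit formula for the measure and from the shape of
  the components. Write \<open>a\<^sub>j\<close> for the row counts, \<open>N\<close> for the number of digits, and index an
  approximate square of rank \<open>k\<close> by its pair of words \<open>(x, y)\<close>, with \<open>\<ell> = \<ell>(k)\<close>.

  The measure. Iterating self-similarity \<open>\<ell>\<close> times writes the measure of a set as an average over
  the \<open>N ^ \<ell>\<close> words of digits. A word contributes to \<open>Q(x, y)\<close> fully if its rows spell \<open>y\<close> and its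
  first \<open>k\<close> columns spell \<open>x\<close>. Any other word contributes at most the measure of two opposite
  sides of the unit square, and in that case two different rows (or columns) are occupied, which makes
  these sides null. Counting words shows that \<open>\<mu>(Q(x, y))\<close> is the product of the row counts of the
  digits \<open>y\<^sub>j\<close> with \<open>j > k\<close>, divided by \<open>N ^ \<ell>\<close>, and gives additivity over distinct approximate squares (\<open>measure_Union_squares\<close>).

  The shape of a component. Read \<open>y\<close> as an integer in base \<open>m\<close>. The integers that occur in a component
  have no gaps, since the projection of the component to the vertical axis is an interval, and
  their last digit is never that of a vacant row. Hence there are at most \<open>m - 1\<close> of
  them, and without their last digits they are equal or consecutive. Together with the bound \<open>M0\<close> on
  the number of basic rectangles, a component has at most \<open>(m - 1) M0\<close> members
  (\<open>card_codes_in_le\<close>).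

  Ratios. Consecutive integers differ by one carry: digits \<open>c\<close> and \<open>c + 1\<close>, followed by equally many
  digits \<open>m - 1\<close> and \<open>0\<close>. If both patterns occur, then doubling forces \<open>a\<^sub>0 = a\<^bsub>m-1\<^esub>\<close>, because long carries
  would otherwise give neighbouring squares of unbounded measure ratio
  (\<open>doubling_extreme_rows_eq\<close>). So only the carry digit and the last digit contribute to the
  ratio of the measures of two members, which has the form \<open>(a\<^sub>p a\<^sub>q) / (a\<^sub>r a\<^sub>s)\<close>. The
  denominator divides \<open>P\<^sup>2\<close>, where \<open>P\<close> is the product of the distinct non-zero row counts, and summing
  over the members gives part (i).

  For part (ii), let \<open>B'\<close> be a member of \<open>U'\<close> and \<open>B\<close> the member of \<open>U\<close> that contains it. The ratio is
  \<open>\<mu>(U')/\<mu>(B') * \<mu>(B')/\<mu>(B) * \<mu>(B)/\<mu>(U)\<close>. By part (i) the outer factors have the form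
  \<open>u'/P\<^sup>2\<close> and \<open>P\<^sup>2/u\<close> with \<open>u\<close> bounded, and the middle factor has a denominator that is a row count times a
  bounded power of \<open>N\<close> (\<open>offspring_square_measure\<close>).
\<close>

section \<open>Digit words\<close>

definition digit_value :: "nat \<Rightarrow> nat list \<Rightarrow> nat" where
  "digit_value q xs = foldl (\<lambda>a d. a * q + d) 0 xs"

lemma digit_value_Nil [simp]: "digit_value q [] = 0"
  by (simp add: digit_value_def)

lemma digit_value_snoc [simp]: "digit_value q (xs @ [d]) = digit_value q xs * q + d"
  by (simp add: digit_value_def)

lemma digit_value_append:
  "digit_value q (xs @ ys) = digit_value q xs * q ^ length ys + digit_value q ys"
proof (induction ys rule: rev_induct)
  case (snoc d ys)
  then show ?case
    unfolding append_assoc [symmetric] digit_value_snoc by (simp add: algebra_simps)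
qed simp

lemma digit_value_Cons: "digit_value q (d # ds) = d * q ^ length ds + digit_value q ds"
  using digit_value_append [of q "[d]" ds] digit_value_snoc [of q "[]" d] by simp

lemma digit_value_less:
  assumes "set xs \<subseteq> {0..<q}"
  shows "digit_value q xs < q ^ length xs"
  using assms
proof (induction xs rule: rev_induct)
  case (snoc d xs)
  then have "digit_value q xs + 1 \<le> q ^ length xs" "d < q" by auto
  then have "(digit_value q xs + 1) * q \<le> q ^ length xs * q" by (intro mult_right_mono) auto
  with \<open>d < q\<close> show ?case by (simp add: algebra_simps)
qed simp

lemma digit_value_prefix:
  assumes "set xs \<subseteq> {0..<q}" "k \<le> length xs" "q > 0"
  obtains r where "real (digit_value q xs) =
      real (digit_value q (take k xs)) * real q ^ (length xs - k) + r"
    "0 \<le> r" "r + 1 \<le> real q ^ (length xs - k)"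
proof -
  have "digit_value q xs = digit_value q (take k xs) * q ^ (length xs - k) + digit_value q (drop k xs)"
    using digit_value_append [of q "take k xs" "drop k xs"] by (simp only: append_take_drop_id) simp
  moreover have "set (drop k xs) \<subseteq> {0..<q}"
    using assms(1) set_drop_subset [of k xs] by (rule subset_trans [rotated])
  then have "digit_value q (drop k xs) < q ^ (length xs - k)"
    using digit_value_less [of "drop k xs" q] by simp
  then have "real (digit_value q (drop k xs)) + 1 \<le> real q ^ (length xs - k)"
    by (metis Suc_eq_plus1 Suc_leI of_nat_Suc of_nat_le_iff of_nat_power add.commute)
  ultimately show thesis using that [of "real (digit_value q (drop k xs))"] by simp
qed

text \<open>The \<open>q\<close>-adic interval of a longer word is contained in that of its prefix.\<close>

lemma digit_value_append_bounds:
  fixes t :: real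
  assumes "set ys \<subseteq> {0..<q}" "q > 0"
    and t: "real (digit_value q (xs @ ys)) \<le> t * real q ^ length (xs @ ys)"
      "t * real q ^ length (xs @ ys) \<le> real (digit_value q (xs @ ys)) + 1"
  shows "real (digit_value q xs) \<le> t * real q ^ length xs"
    "t * real q ^ length xs \<le> real (digit_value q xs) + 1"
proof -
  have pos: "real q ^ length ys > 0" using assms(2) by simp
  have "real (digit_value q ys + 1) \<le> real (q ^ length ys)"
    using digit_value_less [OF assms(1)] by (intro of_nat_mono) simp
  then have "real (digit_value q xs) * real q ^ length ys \<le> (t * real q ^ length xs) * real q ^ length ys"
    "(t * real q ^ length xs) * real q ^ length ys \<le> (real (digit_value q xs) + 1) * real q ^ length ys"
    using t by (auto simp: digit_value_append power_add algebra_simps)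
  then show "real (digit_value q xs) \<le> t * real q ^ length xs"
    "t * real q ^ length xs \<le> real (digit_value q xs) + 1"
    using pos by (auto simp only: mult_le_cancel_right_pos)
qed

lemma mult_add_digit_cancel:
  fixes a b d e q :: nat
  assumes "a * q + d = b * q + e" "d < q" "e < q"
  shows "a = b" "d = e"
  using arg_cong [OF assms(1), of "\<lambda>t. t div q"] arg_cong [OF assms(1), of "\<lambda>t. t mod q"] assms(2,3)
  by simp_all

lemma digit_value_inj:
  assumes "length xs = length ys" "set xs \<subseteq> {0..<q}" "set ys \<subseteq> {0..<q}"
    and "digit_value q xs = digit_value q ys"
  shows "xs = ys"
  using assms
proof (induction xs arbitrary: ys rule: rev_induct)
  case (snoc d xs)
  then obtain zs e where ys: "ys = zs @ [e]"
    by (cases ys rule: rev_cases) auto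
  have de: "d < q" "e < q" using snoc.prems ys by auto
  have eq: "digit_value q xs * q + d = digit_value q zs * q + e"
    using snoc.prems(4) ys by simp
  show ?case using mult_add_digit_cancel [OF eq de] snoc.IH [of zs] snoc.prems ys by auto
qed simp

lemma expansion_eq_digit_value:
  assumes "q > 0"
  shows "expansion q xs = real (digit_value q xs) / real q ^ length xs"
proof (induction xs rule: rev_induct)
  case (snoc d xs)
  have "(\<Sum>j<length xs. real ((xs @ [d]) ! j) / real q ^ (j + 1))
      = (\<Sum>j<length xs. real (xs ! j) / real q ^ (j + 1))"
    by (intro sum.cong) (auto simp: nth_append)
  then have "expansion q (xs @ [d]) = expansion q xs + real d / real q ^ (length xs + 1)"
    by (simp add: expansion_def)
  then show ?case using snoc assms by (simp add: field_simps)
qed (simp add: expansion_def)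

lemma mem_Q_set_iff:
  assumes "n > 0" "m > 0"
  shows "p \<in> Q_set n m x y \<longleftrightarrow>
    real (digit_value n x) \<le> fst p * real n ^ length x \<and>
    fst p * real n ^ length x \<le> real (digit_value n x) + 1 \<and>
    real (digit_value m y) \<le> snd p * real m ^ length y \<and>
    snd p * real m ^ length y \<le> real (digit_value m y) + 1"
  using assms
  by (cases p) (auto simp: Q_set_def expansion_eq_digit_value add_divide_distrib [symmetric]
      divide_le_eq le_divide_eq)

text \<open>The successor of a number changes its digits by one carry: the trailing digits \<open>q - 1\<close>
  become \<open>0\<close> and the digit before them grows by one.\<close>

lemma digit_value_Suc_carry:
  assumes "length xs = length ys" "set xs \<subseteq> {0..<q}" "set ys \<subseteq> {0..<q}"
    and "digit_value q ys = Suc (digit_value q xs)"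
  obtains v c t where "xs = v @ [c] @ replicate t (q - 1)" "ys = v @ [Suc c] @ replicate t 0"
  using assms
proof (induction xs arbitrary: ys thesis rule: rev_induct)
  case (snoc d xs)
  then obtain zs e where ys: "ys = zs @ [e]"
    by (cases ys rule: rev_cases) auto
  have de: "d < q" "e < q" using snoc.prems ys by auto
  have eq: "digit_value q zs * q + e = digit_value q xs * q + Suc d"
    using snoc.prems(5) ys by simp
  show ?case
  proof (cases "Suc d = q")
    case True
    with eq have eq': "digit_value q zs * q + e = Suc (digit_value q xs) * q" by simp
    have e0: "e = 0" and "digit_value q zs = Suc (digit_value q xs)"
      using mult_add_digit_cancel [of "digit_value q zs" q e "Suc (digit_value q xs)" 0] eq' de by auto
    then obtain v c t where v: "xs = v @ [c] @ replicate t (q - 1)" "zs = v @ [Suc c] @ replicate t 0"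
      using snoc.IH [of zs] snoc.prems ys by auto
    have "xs @ [d] = v @ [c] @ replicate (Suc t) (q - 1)"
      using v True by (simp add: replicate_append_same [symmetric])
    moreover have "ys = v @ [Suc c] @ replicate (Suc t) 0"
      using v e0 ys by (simp add: replicate_append_same [symmetric])
    ultimately show ?thesis by (rule snoc.prems(1))
  next
    case False
    with de have d': "Suc d < q" by simp
    note same = mult_add_digit_cancel [OF eq de(2) d']
    then have "zs = xs" using digit_value_inj [of xs zs q] snoc.prems ys by auto
    with same ys show ?thesis using snoc.prems(1) [of xs d 0] by simp
  qed
qed simp

lemma digit_value_replicate_0 [simp]: "digit_value q (replicate t 0) = 0"
  by (induction t) (auto simp: digit_value_Cons)

lemma digit_value_replicate_top:
  assumes "q > 0"
  shows "digit_value q (replicate t (q - 1)) + 1 = q ^ t"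
proof (induction t)
  case (Suc t)
  have "digit_value q (replicate (Suc t) (q - 1)) + 1 = (q - 1) * q ^ t + (digit_value q (replicate t (q - 1)) + 1)"
    by (simp add: digit_value_Cons)
  also have "\<dots> = (q - 1 + 1) * q ^ t" unfolding Suc.IH by (simp only: add_mult_distrib mult_1)
  finally show ?case using assms by simp
qed simp

lemma digit_value_carry:
  assumes "q > 0"
  shows "digit_value q (v @ [Suc c] @ replicate t 0) = Suc (digit_value q (v @ [c] @ replicate t (q - 1)))"
proof -
  have "digit_value q ((v @ [c]) @ replicate t (q - 1)) + 1 = digit_value q (v @ [c]) * q ^ t + q ^ t"
    using digit_value_replicate_top [OF assms, of t] unfolding digit_value_append [of q "v @ [c]"] by simp
  moreover have "digit_value q ((v @ [Suc c]) @ replicate t 0) = (digit_value q (v @ [c]) + 1) * q ^ t"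
    unfolding digit_value_append [of q "v @ [Suc c]"] by simp
  ultimately show ?thesis by simp
qed

lemma unit_steps_meet_at_ends:
  fixes V V' :: nat and s :: real
  assumes "V \<noteq> V'" "0 \<le> s" "s \<le> 1" "real V' \<le> real V + s" "real V + s \<le> real V' + 1"
  shows "s = 0 \<or> s = 1"
proof (cases "V < V'")
  case True
  then have "real V + 1 \<le> real V'" by simp
  then show ?thesis using assms by linarith
next
  case False
  with assms(1) have "real V' + 1 \<le> real V" by simp
  then show ?thesis using assms by linarith
qed

text \<open>The defining property of \<open>\<ell>(k)\<close> in integers: the height \<open>m\<close> to the power \<open>-\<ell>(k)\<close> of an
  approximate square is at least its width and less than \<open>m\<close> times its width. All later estimates
  on \<open>\<ell>\<close> come from these two inequalities.\<close>

lemma ell_bounds: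
  assumes "2 \<le> m" "m < n"
  shows ell_power_le: "m ^ ell n m k \<le> n ^ k"
    and ell_power_less: "n ^ k < m ^ (ell n m k + 1)"
proof -
  let ?t = "real k / sigma n m"
  have lnm: "ln (real m) > 0" and lnn: "ln (real n) > 0" using assms by auto
  have t: "?t * ln (real m) = real k * ln (real n)" using lnm lnn by (simp add: sigma_def)
  have "?t \<ge> 0" using lnm lnn by (simp add: sigma_def)
  then have l: "real (ell n m k) \<le> ?t" "?t < real (ell n m k) + 1"
    by (auto simp: ell_def)
  have "real (ell n m k) * ln (real m) \<le> real k * ln (real n)"
    using l(1) lnm t by (metis less_imp_le mult_right_mono)
  then have "ln (real m ^ ell n m k) \<le> ln (real n ^ k)"
    using assms by (simp add: ln_realpow)
  then have "real m ^ ell n m k \<le> real n ^ k" using assms by simp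
  then show "m ^ ell n m k \<le> n ^ k" by (simp flip: of_nat_power)
  have "real k * ln (real n) < (real (ell n m k) + 1) * ln (real m)"
    using l(2) lnm t by (metis mult_strict_right_mono)
  then have "ln (real n ^ k) < ln (real m ^ (ell n m k + 1))"
    using assms by (simp add: ln_realpow algebra_simps ln_mult)
  then have "real n ^ k < real m ^ (ell n m k + 1)" using assms
    by (subst (asm) ln_less_cancel_iff) auto
  then show "n ^ k < m ^ (ell n m k + 1)" by (metis of_nat_less_iff of_nat_power)
qed

lemma le_ell:
  assumes "2 \<le> m" "m < n"
  shows "k \<le> ell n m k"
proof -
  have "m ^ k \<le> n ^ k" using assms by (simp add: power_mono)
  then have "m ^ k < m ^ (ell n m k + 1)" using ell_power_less [OF assms, of k] by simp
  then have "k < ell n m k + 1" using assms by (subst (asm) power_strict_increasing_iff) auto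
  then show ?thesis by simp
qed

lemma ell_Suc_le:
  assumes "2 \<le> m" "m < n"
  shows "ell n m (Suc k) \<le> ell n m k + n"
proof -
  have "n < m ^ n"
    using assms less_exp [of n] power_mono [of 2 m n] by linarith
  have "m ^ ell n m (Suc k) \<le> n * n ^ k" using ell_power_le [OF assms, of "Suc k"] by simp
  also have "\<dots> < m ^ n * m ^ (ell n m k + 1)"
    using ell_power_less [OF assms, of k] \<open>n < m ^ n\<close> assms by (intro mult_strict_mono) auto
  also have "\<dots> = m ^ (ell n m k + n + 1)" by (simp add: power_add)
  finally have "ell n m (Suc k) < ell n m k + n + 1"
    using assms by (subst (asm) power_strict_increasing_iff) auto
  then show ?thesis by simp
qed

lemma ell_le_ell_Suc:
  assumes "2 \<le> m" "m < n"
  shows "ell n m k \<le> ell n m (Suc k)"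
proof -
  have "n ^ k \<le> n ^ Suc k" using assms by (intro power_increasing) auto
  then have "m ^ ell n m k < m ^ (ell n m (Suc k) + 1)"
    using ell_power_le [OF assms, of k] ell_power_less [OF assms, of "Suc k"] by linarith
  then have "ell n m k < ell n m (Suc k) + 1"
    using assms by (subst (asm) power_strict_increasing_iff) auto
  then show ?thesis by simp
qed

text \<open>As \<open>n > m\<close>, the second word of an approximate square exceeds the first by arbitrarily many digits.
  These are the positions at which row counts enter the measure.\<close>

lemma ell_minus_unbounded:
  assumes "2 \<le> m" "m < n"
  obtains k where "k + s \<le> ell n m k"
proof -
  have "1 < real n / real m" using assms by simp
  then obtain k where k: "real m ^ (s + 1) < (real n / real m) ^ k"
    using real_arch_pow by blast
  have "real m ^ (k + s + 1) < real n ^ k"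
    using k assms by (simp add: power_divide power_add field_simps)
  then have "m ^ (k + s + 1) < n ^ k" by (metis of_nat_less_iff of_nat_power)
  then have "m ^ (k + s + 1) < m ^ (ell n m k + 1)"
    using ell_power_less [OF assms, of k] by linarith
  then have "k + s + 1 < ell n m k + 1"
    using assms by (subst (asm) power_strict_increasing_iff) auto
  then show thesis using that [of k] by simp
qed

section \<open>Words of affine maps\<close>

definition digit_words :: "(nat \<times> nat) set \<Rightarrow> nat \<Rightarrow> (nat \<times> nat) list set" where
  "digit_words D L = {w. length w = L \<and> set w \<subseteq> D}"

lemma finite_digit_words: "finite D \<Longrightarrow> finite (digit_words D L)"
  using finite_lists_length_eq [of D L] by (simp add: digit_words_def conj_commute)

lemma digit_words_Suc: "digit_words D (Suc L) = (\<lambda>(d, w). d # w) ` (D \<times> digit_words D L)"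
  by (auto simp: digit_words_def length_Suc_conv image_iff)

lemma S_word_Cons: "S_word n m (d # ds) = S_map n m d \<circ> S_word n m ds"
  by (simp add: S_word_def)

lemma S_word_Nil: "S_word n m [] = id"
  by (simp add: S_word_def)

lemma S_word_coordinates:
  assumes "n > 0" "m > 0"
  shows "fst (S_word n m w z) * real n ^ length w = real (digit_value n (map fst w)) + fst z"
    and "snd (S_word n m w z) * real m ^ length w = real (digit_value m (map snd w)) + snd z"
proof (induction w)
  case (Cons d w)
  { case 1 show ?case using Cons assms
      by (simp add: S_word_Cons S_map_def digit_value_Cons field_simps) }
  { case 2 show ?case using Cons assms
      by (simp add: S_word_Cons S_map_def digit_value_Cons field_simps) }
qed (auto simp: S_word_Nil)

lemma S_word_image_unit_square:
  assumes "n > 0" "m > 0"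
  shows "S_word n m w ` ({0..1} \<times> {0..1}) = Q_set n m (map fst w) (map snd w)"
proof (intro equalityI subsetI)
  fix p assume "p \<in> S_word n m w ` ({0..1} \<times> {0..1})"
  then show "p \<in> Q_set n m (map fst w) (map snd w)"
    using S_word_coordinates [OF assms, of w] by (auto simp: mem_Q_set_iff [OF assms])
next
  fix p assume p: "p \<in> Q_set n m (map fst w) (map snd w)"
  define z where "z = (fst p * real n ^ length w - real (digit_value n (map fst w)),
      snd p * real m ^ length w - real (digit_value m (map snd w)))"
  have "z \<in> {0..1} \<times> {0..1}"
    using p by (auto simp: mem_Q_set_iff [OF assms] z_def)
  moreover have "S_word n m w z = p"
    using S_word_coordinates [OF assms, of w z] assms by (auto simp: z_def intro: prod_eqI)
  ultimately show "p \<in> S_word n m w ` ({0..1} \<times> {0..1})" by force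
qed

section \<open>Codes of approximate squares\<close>

definition row_weight :: "(nat \<times> nat) set \<Rightarrow> nat list \<Rightarrow> nat" where
  "row_weight D ys = prod_list (map (row_count D) ys)"

lemma row_weight_simps [simp]:
  "row_weight D [] = 1"
  "row_weight D (y # ys) = row_count D y * row_weight D ys"
  "row_weight D (xs @ ys) = row_weight D xs * row_weight D ys"
  "row_weight D (replicate t y) = row_count D y ^ t"
  by (simp_all add: row_weight_def prod_list_replicate)

lemma row_weight_pos:
  assumes "set ys \<subseteq> nonvacant_rows m D"
  shows "row_weight D ys > 0"
  using assms by (induction ys) (auto simp: nonvacant_rows_def)

text \<open>These are the words of digits whose maps send the unit square into \<open>Q(x, y)\<close>: the columns are
  prescribed only along \<open>x\<close>, the rows along all of \<open>y\<close>.\<close>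

definition word_fibre :: "(nat \<times> nat) set \<Rightarrow> nat list \<Rightarrow> nat list \<Rightarrow> (nat \<times> nat) list set" where
  "word_fibre D x y = {w. set w \<subseteq> D \<and> take (length x) (map fst w) = x \<and> map snd w = y}"

lemma word_fibre_subset: "word_fibre D x y \<subseteq> digit_words D (length y)"
  by (auto simp: word_fibre_def digit_words_def)

text \<open>Along \<open>x\<close> the digits of a word are determined; at a later position with row \<open>b\<close> any of the
  digits in that row may occur.\<close>

lemma card_word_fibre:
  assumes "finite D" "length x \<le> length y" "set (zip x y) \<subseteq> D"
  shows "card (word_fibre D x y) = row_weight D (drop (length x) y)"
  using assms(2,3)
proof (induction x arbitrary: y)
  case Nil
  show ?case
  proof (induction y)
    case Nil
    have "word_fibre D [] [] = {[]}" by (auto simp: word_fibre_def)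
    then show ?case by simp
  next
    case (Cons b y)
    let ?R = "{i. (i, b) \<in> D}"
    have "word_fibre D [] (b # y) = (\<lambda>(i, w). (i, b) # w) ` (?R \<times> word_fibre D [] y)"
      by (auto simp: word_fibre_def image_iff map_eq_Cons_conv)
    moreover have "inj_on (\<lambda>(i, w). (i, b) # w) (?R \<times> word_fibre D [] y)"
      by (auto simp: inj_on_def)
    ultimately have "card (word_fibre D [] (b # y)) = row_count D b * card (word_fibre D [] y)"
      by (simp add: card_image card_cartesian_product row_count_def)
    with Cons show ?case by simp
  qed
next
  case (Cons a x)
  then obtain b y' where y: "y = b # y'" by (cases y) auto
  have "word_fibre D (a # x) y = (\<lambda>w. (a, b) # w) ` word_fibre D x y'"
    using Cons.prems y by (auto simp: word_fibre_def image_iff map_eq_Cons_conv)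
  then show ?case using Cons.IH [of y'] Cons.prems y by (simp add: card_image)
qed

text \<open>Approximate squares are handled through their pairs of words, since the row weight is a function of
  the word \<open>y\<close>, not visibly of the set. The conditions on single positions are expressed by \<open>zip\<close> and \<open>drop\<close>,
  which suits induction on words.\<close>

definition square_codes :: "nat \<Rightarrow> nat \<Rightarrow> (nat \<times> nat) set \<Rightarrow> nat \<Rightarrow> (nat list \<times> nat list) set" where
  "square_codes n m D k = {(x, y). length x = k \<and> length y = ell n m k \<and>
     set (zip x y) \<subseteq> D \<and> set (drop k y) \<subseteq> nonvacant_rows m D}"

locale carpet =
  fixes n m :: nat and D :: "(nat \<times> nat) set" and E :: "(real \<times> real) set"
    and \<mu> :: "(real \<times> real) measure"
  assumes m_ge_2: "2 \<le> m" and m_less_n: "m < n"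
    and digit_set: "digit_set n m D"
    and carpet: "is_carpet n m D E"
    and bernoulli: "is_uniform_bernoulli n m D E \<mu>"
begin

lemma n_pos: "n > 0" and m_pos: "m > 0"
  using m_ge_2 m_less_n by auto

lemma finite_D: "finite D"
  using digit_set finite_subset [of D "{0..<n} \<times> {0..<m}"] by (auto simp: digit_set_def)

lemma D_bounds: "d \<in> D \<Longrightarrow> fst d < n" "d \<in> D \<Longrightarrow> snd d < m"
  using digit_set by (auto simp: digit_set_def)

lemma card_D_pos: "card D > 0"
  using digit_set finite_D by (auto simp: digit_set_def card_gt_0_iff)

lemma k_le_ell: "k \<le> ell n m k"
  using le_ell [OF m_ge_2 m_less_n] .

lemma finite_row: "finite {i. (i, j) \<in> D}"
  by (rule finite_subset [of _ "fst ` D"]) (use finite_D in \<open>auto simp: rev_image_eqI\<close>)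

lemma nonvacant_iff: "j \<in> nonvacant_rows m D \<longleftrightarrow> j \<in> snd ` D"
proof
  assume "j \<in> nonvacant_rows m D"
  then have "card {i. (i, j) \<in> D} > 0" by (auto simp: nonvacant_rows_def row_count_def)
  then have "{i. (i, j) \<in> D} \<noteq> {}" by (auto simp only: card.empty)
  then show "j \<in> snd ` D" by force
next
  assume "j \<in> snd ` D"
  then obtain i where "(i, j) \<in> D" by force
  then show "j \<in> nonvacant_rows m D"
    using finite_row [of j] D_bounds [of "(i, j)"]
    by (auto simp: nonvacant_rows_def row_count_def card_gt_0_iff)
qed

lemma square_codes_set:
  assumes "(x, y) \<in> square_codes n m D k"
  shows "set x \<subseteq> fst ` D" "set y \<subseteq> snd ` D" "set x \<subseteq> {0..<n}" "set y \<subseteq> {0..<m}"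
proof -
  have len: "length x = k" "k \<le> length y" and zip: "set (zip x y) \<subseteq> D"
    and dr: "set (drop k y) \<subseteq> snd ` D"
    using assms k_le_ell [of k] nonvacant_iff by (auto simp: square_codes_def)
  have "map fst (zip x y) = x" "map snd (zip x y) = take k y"
    using len by (simp_all add: map_fst_zip_take map_snd_zip_take)
  then have "set x = fst ` set (zip x y)" "set (take k y) = snd ` set (zip x y)"
    by (metis set_map)+
  then show 1: "set x \<subseteq> fst ` D" and "set y \<subseteq> snd ` D"
    using zip dr set_append [of "take k y" "drop k y"] by auto
  then show "set x \<subseteq> {0..<n}" "set y \<subseteq> {0..<m}" using D_bounds by auto
qed

lemma approx_squares_eq: "approx_squares n m D k = (\<lambda>(x, y). Q_set n m x y) ` square_codes n m D k"
  (is "?L = ?R")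
proof (intro equalityI subsetI)
  fix B assume "B \<in> ?L"
  then obtain x y where xy: "B = Q_set n m x y" "length x = k" "length y = ell n m k"
      "\<forall>j<k. (x ! j, y ! j) \<in> D" "\<forall>j. k \<le> j \<and> j < ell n m k \<longrightarrow> y ! j \<in> nonvacant_rows m D"
    by (auto simp: approx_squares_def)
  then have "(x, y) \<in> square_codes n m D k"
    by (auto simp: square_codes_def set_zip set_conv_nth)
  then show "B \<in> ?R" using xy(1) by force
next
  fix B assume "B \<in> ?R"
  then obtain x y where xy: "B = Q_set n m x y" "(x, y) \<in> square_codes n m D k" by auto
  have len: "length x = k" "length y = ell n m k" and zip: "set (zip x y) \<subseteq> D"
    and dr: "set (drop k y) \<subseteq> nonvacant_rows m D"
    using xy(2) by (auto simp: square_codes_def)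
  have "(x ! j, y ! j) \<in> D" if "j < k" for j
    using zip that len k_le_ell [of k] by (auto simp: set_zip)
  moreover have "y ! j \<in> nonvacant_rows m D" if "k \<le> j" "j < ell n m k" for j
  proof -
    have "y ! j = drop k y ! (j - k)" "j - k < length (drop k y)" using that len by auto
    then show ?thesis using dr nth_mem by (metis subsetD)
  qed
  ultimately show "B \<in> ?L"
    using xy(1) len square_codes_set [OF xy(2)] unfolding approx_squares_def by blast
qed

lemma finite_square_codes: "finite (square_codes n m D k)"
proof (rule finite_subset)
  show "square_codes n m D k \<subseteq> {x. set x \<subseteq> {0..<n} \<and> length x = k} \<times>
      {y. set y \<subseteq> {0..<m} \<and> length y = ell n m k}"
  proof
    fix c assume c: "c \<in> square_codes n m D k"
    then obtain x y where "c = (x, y)" "length x = k" "length y = ell n m k"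
      by (auto simp: square_codes_def)
    then show "c \<in> {x. set x \<subseteq> {0..<n} \<and> length x = k} \<times>
        {y. set y \<subseteq> {0..<m} \<and> length y = ell n m k}"
      using c square_codes_set(3,4) by simp
  qed
qed (simp add: finite_lists_length_eq)

section \<open>The measure of unions of approximate squares\<close>

lemma sets_mu [simp, measurable_cong]: "sets \<mu> = sets borel"
  and measure_UNIV [simp]: "measure \<mu> UNIV = 1"
  and measure_step: "A \<in> sets borel \<Longrightarrow>
    measure \<mu> A = (\<Sum>d\<in>D. measure \<mu> (S_map n m d -` A)) / real (card D)"
  using bernoulli by (auto simp: is_uniform_bernoulli_def measure_def sum_divide_distrib)

lemma space_mu [simp]: "space \<mu> = UNIV"
  using sets_eq_imp_space_eq [OF sets_mu] by simp

lemma finite_measure_mu: "finite_measure \<mu>"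
  using bernoulli by (intro finite_measureI) (simp add: is_uniform_bernoulli_def)

lemma compact_E: "compact E" and E_nonempty: "E \<noteq> {}"
  and E_fixed: "E = (\<Union>d\<in>D. S_map n m d ` E)"
  using carpet by (auto simp: is_carpet_def)

lemma E_borel: "E \<in> sets borel"
  using compact_E by (simp add: borel_compact)

lemma E_subset_unit_square: "E \<subseteq> {0..1} \<times> {0..1}"
proof -
  \<comment> \<open>An extreme value of a coordinate on \<open>E\<close> is attained, and self-similarity bounds it by itself.\<close>
  have bound: "0 \<le> \<pi> z \<and> \<pi> z \<le> 1"
    if \<pi>: "continuous_on E \<pi>" and q: "2 \<le> q"
      and step: "\<And>d z. d \<in> D \<Longrightarrow> \<pi> (S_map n m d z) = (\<pi> z + real (\<delta> d)) / real q"
      and \<delta>: "\<And>d. d \<in> D \<Longrightarrow> \<delta> d < q" and z: "z \<in> E"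
    for \<pi> :: "real \<times> real \<Rightarrow> real" and \<delta> :: "nat \<times> nat \<Rightarrow> nat" and q z
  proof -
    obtain a where a: "a \<in> E" "\<And>z. z \<in> E \<Longrightarrow> \<pi> z \<le> \<pi> a"
      using continuous_attains_sup [OF compact_E E_nonempty \<pi>] by blast
    obtain b where b: "b \<in> E" "\<And>z. z \<in> E \<Longrightarrow> \<pi> b \<le> \<pi> z"
      using continuous_attains_inf [OF compact_E E_nonempty \<pi>] by blast
    obtain d a' where d: "d \<in> D" "a' \<in> E" "a = S_map n m d a'" using a(1) E_fixed by blast
    have "real q * \<pi> a = \<pi> a' + real (\<delta> d)" using step [OF d(1), of a'] d(3) q by simp
    also have "\<dots> \<le> \<pi> a + (real q - 1)" using a(2) [OF d(2)] \<delta> [OF d(1)] by auto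
    finally have "(real q - 1) * (\<pi> a - 1) \<le> 0" by (simp add: algebra_simps)
    then have "\<pi> a \<le> 1" using q by (simp add: mult_le_0_iff)
    obtain e b' where e: "e \<in> D" "b' \<in> E" "b = S_map n m e b'" using b(1) E_fixed by blast
    have "\<pi> b \<le> \<pi> b' + real (\<delta> e)" using b(2) [OF e(2)] by simp
    also have "\<dots> = real q * \<pi> b" using step [OF e(1), of b'] e(3) q by simp
    finally have "0 \<le> (real q - 1) * \<pi> b" by (simp add: algebra_simps)
    then have "0 \<le> \<pi> b" using q by (simp add: zero_le_mult_iff)
    with \<open>\<pi> a \<le> 1\<close> show ?thesis using a(2) [OF z] b(2) [OF z] by linarith
  qed
  have "0 \<le> fst z \<and> fst z \<le> 1" if "z \<in> E" for z
    using m_ge_2 m_less_n D_bounds(1) that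
    by (intro bound [where q = n and \<delta> = fst]) (auto simp: S_map_def intro!: continuous_intros)
  moreover have "0 \<le> snd z \<and> snd z \<le> 1" if "z \<in> E" for z
    using m_ge_2 D_bounds(2) that
    by (intro bound [where q = m and \<delta> = snd]) (auto simp: S_map_def intro!: continuous_intros)
  ultimately show ?thesis by (auto simp: mem_Times_iff)
qed

lemma E_measure: "measure \<mu> E = 1"
  using bernoulli by (simp add: is_uniform_bernoulli_def measure_def)

lemma measure_disjoint_E:
  assumes "A \<in> sets borel" "A \<inter> E = {}"
  shows "measure \<mu> A = 0"
proof -
  interpret finite_measure \<mu> by (rule finite_measure_mu)
  have "measure \<mu> (A \<union> E) = measure \<mu> A + measure \<mu> E"
    using assms E_borel by (intro finite_measure_Union) auto
  moreover have "measure \<mu> (A \<union> E) \<le> 1"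
    using finite_measure_mono [of "A \<union> E" UNIV] by simp
  ultimately show ?thesis using E_measure measure_nonneg [of \<mu> A] by linarith
qed

lemma measure_superset_E:
  assumes "A \<in> sets borel" "E \<subseteq> A"
  shows "measure \<mu> A = 1"
proof -
  interpret finite_measure \<mu> by (rule finite_measure_mu)
  show ?thesis
    using finite_measure_mono [of E A] finite_measure_mono [of A UNIV] assms E_measure by simp
qed

lemma S_map_measurable [measurable]: "S_map n m d \<in> borel_measurable borel"
proof -
  have "continuous_on UNIV (S_map n m d)"
    using n_pos m_pos unfolding S_map_def by (intro continuous_intros) auto
  then show ?thesis by (rule borel_measurable_continuous_onI)
qed

lemma S_word_measurable [measurable]: "S_word n m w \<in> borel_measurable borel"
  by (induction w) (auto simp: S_word_Nil S_word_Cons id_def intro: measurable_comp)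

lemma vimage_borel:
  "A \<in> sets borel \<Longrightarrow> S_map n m d -` A \<in> sets borel"
  "A \<in> sets borel \<Longrightarrow> S_word n m w -` A \<in> sets borel"
  using measurable_sets [OF S_map_measurable, of A] measurable_sets [OF S_word_measurable, of A]
  by auto

lemma measure_words:
  assumes "A \<in> sets borel"
  shows "measure \<mu> A = (\<Sum>w\<in>digit_words D L. measure \<mu> (S_word n m w -` A)) / real (card D) ^ L"
  using assms
proof (induction L arbitrary: A)
  case 0
  have "digit_words D 0 = {[]}" by (auto simp: digit_words_def)
  then show ?case by (simp add: S_word_Nil)
next
  case (Suc L)
  have "(\<Sum>w\<in>digit_words D (Suc L). measure \<mu> (S_word n m w -` A))
      = (\<Sum>(d, w)\<in>D \<times> digit_words D L. measure \<mu> (S_word n m (d # w) -` A))"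
    unfolding digit_words_Suc by (subst sum.reindex) (auto simp: inj_on_def intro: sum.cong)
  also have "\<dots> = (\<Sum>d\<in>D. \<Sum>w\<in>digit_words D L. measure \<mu> (S_word n m w -` (S_map n m d -` A)))"
    by (simp add: sum.cartesian_product S_word_Cons vimage_comp [symmetric])
  also have "\<dots> = (\<Sum>d\<in>D. measure \<mu> (S_map n m d -` A) * real (card D) ^ L)"
    using Suc.IH [OF vimage_borel(1) [OF Suc.prems]] card_D_pos
    by (intro sum.cong) (auto simp: field_simps)
  also have "\<dots> = measure \<mu> A * real (card D) ^ Suc L"
    using measure_step [OF Suc.prems] card_D_pos by (simp add: sum_distrib_right [symmetric])
  finally show ?case using card_D_pos by simp
qed

text \<open>A side of the unit square is met by exactly those maps \<open>S_d\<close> whose digit is the extreme one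
  on that side, and each of these pulls the side back to itself. So the measure of the side is
  \<open>p\<close> times itself, where \<open>p\<close> is the proportion of such digits, and \<open>p < 1\<close> as soon as two
  different digits occur.\<close>

lemma measure_side_eq_0:
  fixes \<pi> :: "real \<times> real \<Rightarrow> real" and \<delta> :: "nat \<times> nat \<Rightarrow> nat"
  assumes \<pi>: "\<pi> = fst \<and> \<delta> = fst \<and> q = n \<or> \<pi> = snd \<and> \<delta> = snd \<and> q = m"
    and d: "d \<in> D" "d' \<in> D" "\<delta> d \<noteq> \<delta> d'" and c: "c \<in> {0, 1}"
  shows "measure \<mu> {z. \<pi> z = c} = 0"
proof -
  let ?side = "\<lambda>c. {z. \<pi> z = c}"
  have meas: "?side t \<in> sets borel" for t
    using \<pi> by (intro borel_closed closed_Collect_eq) (auto intro!: continuous_intros)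
  have q: "q > 0" using \<pi> n_pos m_pos by auto
  have \<delta>: "\<delta> d < q" if "d \<in> D" for d using \<pi> D_bounds [OF that] by auto
  have pull: "S_map n m d -` ?side c = ?side (real q * c - real (\<delta> d))" for d
    using \<pi> q by (auto simp: S_map_def field_simps)
  \<comment> \<open>The digits whose maps pull the side back to itself.\<close>
  define K where "K = {d \<in> D. real q * c - real (\<delta> d) = c}"
  have K: "K \<subset> D"
  proof -
    have "\<not> (d \<in> K \<and> d' \<in> K)" using d(3) by (auto simp: K_def)
    then have "K \<noteq> D" using d by blast
    then show ?thesis by (auto simp: K_def)
  qed
  have out: "measure \<mu> (S_map n m d -` ?side c) = 0" if "d \<in> D - K" for d
  proof -
    have "real q * c - real (\<delta> d) \<notin> {0..1}" using that c \<delta> [of d] by (auto simp: K_def)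
    then have "?side (real q * c - real (\<delta> d)) \<inter> E = {}"
      using E_subset_unit_square \<pi> by fastforce
    then show ?thesis unfolding pull using meas by (rule measure_disjoint_E [rotated])
  qed
  have "measure \<mu> (?side c) * real (card D) = (\<Sum>d\<in>D. measure \<mu> (S_map n m d -` ?side c))"
    using measure_step [OF meas] card_D_pos by simp
  also have "\<dots> = (\<Sum>d\<in>K. measure \<mu> (S_map n m d -` ?side c))"
    using out finite_D K by (intro sum.mono_neutral_right) auto
  also have "\<dots> = real (card K) * measure \<mu> (?side c)"
    unfolding pull by (simp add: K_def)
  finally have "(real (card D) - real (card K)) * measure \<mu> (?side c) = 0"
    by (simp add: algebra_simps)
  then show ?thesis using psubset_card_mono [OF finite_D K] by auto
qed

lemma measure_meets_in_sides_eq_0: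
  fixes \<pi> :: "real \<times> real \<Rightarrow> real" and \<delta> :: "nat \<times> nat \<Rightarrow> nat"
  assumes \<pi>: "\<pi> = fst \<and> \<delta> = fst \<and> q = n \<or> \<pi> = snd \<and> \<delta> = snd \<and> q = m"
    and d: "d \<in> D" "d' \<in> D" "\<delta> d \<noteq> \<delta> d'"
    and A: "A \<in> sets borel"
    and sides: "\<And>z. z \<in> A \<Longrightarrow> z \<in> {0..1} \<times> {0..1} \<Longrightarrow> \<pi> z = 0 \<or> \<pi> z = 1"
  shows "measure \<mu> A = 0"
proof -
  interpret finite_measure \<mu> by (rule finite_measure_mu)
  let ?side = "\<lambda>c. {z. \<pi> z = c}"
  have meas: "?side c \<in> sets borel" for c
    using \<pi> by (intro borel_closed closed_Collect_eq) (auto intro!: continuous_intros)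
  have "A \<subseteq> (A - E) \<union> (?side 0 \<union> ?side 1)"
    using sides E_subset_unit_square by auto
  then have "measure \<mu> A \<le> measure \<mu> ((A - E) \<union> (?side 0 \<union> ?side 1))"
    using A E_borel meas by (intro finite_measure_mono) auto
  also have "\<dots> \<le> measure \<mu> (A - E) + (measure \<mu> (?side 0) + measure \<mu> (?side 1))"
    using A E_borel meas
    by (intro order_trans [OF measure_Un_le] add_left_mono measure_Un_le) auto
  also have "\<dots> = 0"
    using measure_side_eq_0 [OF \<pi> d] A E_borel measure_disjoint_E [of "A - E"] by auto
  finally show ?thesis using measure_nonneg [of \<mu> A] by linarith
qed

lemma fst_S_word_prefix:
  assumes w: "w \<in> digit_words D L" and k: "k \<le> L"
  obtains r where "fst (S_word n m w z) * real n ^ k =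
      real (digit_value n (take k (map fst w))) + (r + fst z) / real n ^ (L - k)"
    "0 \<le> r" "r + 1 \<le> real n ^ (L - k)"
proof -
  have w': "set (map fst w) \<subseteq> {0..<n}" "length w = L"
    using w D_bounds by (auto simp: digit_words_def)
  obtain r where r: "real (digit_value n (map fst w)) =
      real (digit_value n (take k (map fst w))) * real n ^ (L - k) + r"
    "0 \<le> r" "r + 1 \<le> real n ^ (L - k)"
    using digit_value_prefix [OF w'(1), of k] w' k n_pos by auto
  have pow: "real n ^ L = real n ^ k * real n ^ (L - k)"
    using k by (simp flip: power_add)
  have "fst (S_word n m w z) * real n ^ k * real n ^ (L - k) =
      real (digit_value n (take k (map fst w))) * real n ^ (L - k) + r + fst z"
    using S_word_coordinates(1) [OF n_pos m_pos, of w z] r(1) w' pow by (simp add: mult.assoc)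
  then have "fst (S_word n m w z) * real n ^ k =
      real (digit_value n (take k (map fst w))) + (r + fst z) / real n ^ (L - k)"
    using n_pos by (simp add: field_simps)
  then show thesis using that r by blast
qed

lemma S_word_vimage_square_superset:
  assumes code: "(x, y) \<in> square_codes n m D k" and w: "w \<in> word_fibre D x y"
  shows "S_word n m w -` Q_set n m x y \<supseteq> {0..1} \<times> {0..1}"
proof
  fix z :: "real \<times> real" assume z: "z \<in> {0..1} \<times> {0..1}"
  let ?L = "ell n m k"
  have len: "length x = k" "length y = ?L" using code by (auto simp: square_codes_def)
  have w': "take k (map fst w) = x" "map snd w = y" "length w = ?L" "set w \<subseteq> D"
    using w len by (auto simp: word_fibre_def)
  have W: "w \<in> digit_words D ?L" using w' by (simp add: digit_words_def)
  obtain r where r: "fst (S_word n m w z) * real n ^ k =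
      real (digit_value n x) + (r + fst z) / real n ^ (?L - k)"
    "0 \<le> r" "r + 1 \<le> real n ^ (?L - k)"
    using fst_S_word_prefix [OF W k_le_ell, of z] w'(1) by auto
  have "0 \<le> (r + fst z) / real n ^ (?L - k)" "(r + fst z) / real n ^ (?L - k) \<le> 1"
    using z r n_pos by (auto simp: divide_le_eq)
  with r(1) have "real (digit_value n x) \<le> fst (S_word n m w z) * real n ^ k"
      "fst (S_word n m w z) * real n ^ k \<le> real (digit_value n x) + 1" by auto
  then show "z \<in> S_word n m w -` Q_set n m x y"
    using S_word_coordinates(2) [OF n_pos m_pos, of w z] w' len z
    by (auto simp: mem_Q_set_iff [OF n_pos m_pos])
qed

text \<open>A word outside the fibre of \<open>(x, y)\<close> differs from \<open>y\<close> in a row or from \<open>x\<close> in a column. Its rectangle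
  then meets \<open>Q(x, y)\<close> at most along a common edge, whose preimage in the unit square lies in two sides.
  The digits at the place of difference show that two rows or two columns are occupied, so
  these sides are null.\<close>

lemma measure_S_word_vimage_square_eq_0:
  assumes code: "(x, y) \<in> square_codes n m D k"
    and w: "w \<in> digit_words D (ell n m k)" "w \<notin> word_fibre D x y"
  shows "measure \<mu> (S_word n m w -` Q_set n m x y) = 0"
proof -
  let ?A = "S_word n m w -` Q_set n m x y"
  let ?L = "ell n m k"
  have len: "length x = k" "length y = ?L" "length w = ?L" and wD: "set w \<subseteq> D"
    using code w by (auto simp: square_codes_def digit_words_def)
  have A: "?A \<in> sets borel"
    by (intro vimage_borel borel_closed) (auto simp: Q_set_def intro: closed_Times)
  show ?thesis
  proof (cases "map snd w = y")
    case False
    then obtain j where j: "j < ?L" "snd (w ! j) \<noteq> y ! j"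
      using len by (auto simp: list_eq_iff_nth_eq)
    have "y ! j \<in> snd ` D" using square_codes_set(2) [OF code] j len nth_mem [of j y] by auto
    then obtain d where d: "d \<in> D" "snd d = y ! j" by auto
    have w': "set (map snd w) \<subseteq> {0..<m}" using wD D_bounds by auto
    have "digit_value m (map snd w) \<noteq> digit_value m y"
      using digit_value_inj [OF _ w' square_codes_set(4) [OF code]] False len by auto
    moreover have "real (digit_value m y) \<le> real (digit_value m (map snd w)) + snd z"
        "real (digit_value m (map snd w)) + snd z \<le> real (digit_value m y) + 1" if "z \<in> ?A" for z
      using that S_word_coordinates(2) [OF n_pos m_pos, of w z] len
      by (auto simp: mem_Q_set_iff [OF n_pos m_pos])
    ultimately have "snd z = 0 \<or> snd z = 1" if "z \<in> ?A" "z \<in> {0..1} \<times> {0..1}" for z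
      using that unit_steps_meet_at_ends [of "digit_value m (map snd w)" "digit_value m y" "snd z"]
      by (auto simp: mem_Times_iff)
    then show ?thesis
      using d j wD len by (intro measure_meets_in_sides_eq_0 [where \<pi> = snd and \<delta> = snd
          and d = "w ! j" and d' = d and q = m] A) auto
  next
    case True
    let ?x' = "take k (map fst w)"
    have neq: "?x' \<noteq> x" using True w len wD by (auto simp: word_fibre_def)
    have len': "length ?x' = k" using len k_le_ell [of k] by simp
    then obtain j where j: "j < k" "fst (w ! j) \<noteq> x ! j"
      using len neq k_le_ell [of k] by (auto simp: list_eq_iff_nth_eq)
    have jL: "j < length w" using j len k_le_ell [of k] by simp
    have "x ! j \<in> fst ` D" using square_codes_set(1) [OF code] j len nth_mem [of j x] by auto
    then obtain d where d: "d \<in> D" "fst d = x ! j" by auto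
    have "set ?x' \<subseteq> {0..<n}" using wD D_bounds set_take_subset [of k "map fst w"] by fastforce
    then have dv: "digit_value n ?x' \<noteq> digit_value n x"
      using digit_value_inj [of ?x' x n] square_codes_set(3) [OF code] neq len' len by auto
    have "fst z = 0 \<or> fst z = 1" if z: "z \<in> ?A" "z \<in> {0..1} \<times> {0..1}" for z
    proof -
      obtain r where r: "fst (S_word n m w z) * real n ^ k =
          real (digit_value n ?x') + (r + fst z) / real n ^ (?L - k)"
        "0 \<le> r" "r + 1 \<le> real n ^ (?L - k)"
        using fst_S_word_prefix [OF w(1) k_le_ell, of z] by auto
      let ?s = "(r + fst z) / real n ^ (?L - k)"
      have s: "0 \<le> ?s" "?s \<le> 1" using z r n_pos by (auto simp: divide_le_eq mem_Times_iff)
      have "real (digit_value n x) \<le> real (digit_value n ?x') + ?s"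
        "real (digit_value n ?x') + ?s \<le> real (digit_value n x) + 1"
        using z(1) r(1) len by (auto simp: mem_Q_set_iff [OF n_pos m_pos])
      then have "?s = 0 \<or> ?s = 1"
        using s dv by (intro unit_steps_meet_at_ends)
      then have "r + fst z = 0 \<or> r + fst z = real n ^ (?L - k)"
        using n_pos by auto
      then show ?thesis using r z by (auto simp: mem_Times_iff)
    qed
    then show ?thesis
      using d j wD jL by (intro measure_meets_in_sides_eq_0 [where \<pi> = fst and \<delta> = fst
          and d = "w ! j" and d' = d and q = n] A) auto
  qed
qed

lemma Q_set_borel: "Q_set n m x y \<in> sets borel"
  by (intro borel_closed) (auto simp: Q_set_def intro: closed_Times)

lemma card_code_fibre:
  assumes "(x, y) \<in> square_codes n m D k"
  shows "card (word_fibre D x y) = row_weight D (drop k y)"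
  using assms card_word_fibre [OF finite_D, of x y] k_le_ell [of k] by (auto simp: square_codes_def)

lemma finite_word_fibre: "finite (word_fibre D x y)"
  using finite_digit_words [OF finite_D] word_fibre_subset by (rule finite_subset [rotated])

text \<open>The fibres of distinct codes are disjoint, so counting the words that contribute to a union of
  approximate squares gives a sum over the squares.\<close>

lemma measure_Union_squares:
  assumes C: "C \<subseteq> square_codes n m D k"
  shows "measure \<mu> (\<Union>(x, y)\<in>C. Q_set n m x y)
    = real (\<Sum>(x, y)\<in>C. row_weight D (drop k y)) / real (card D) ^ ell n m k"
proof -
  interpret finite_measure \<mu> by (rule finite_measure_mu)
  let ?A = "\<Union>(x, y)\<in>C. Q_set n m x y"
  let ?W = "digit_words D (ell n m k)"
  let ?F = "\<Union>(x, y)\<in>C. word_fibre D x y"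
  have fin: "finite C" using C finite_square_codes finite_subset by blast
  have A: "?A \<in> sets borel" using fin Q_set_borel by (intro sets.finite_UN) auto
  have FW: "?F \<subseteq> ?W"
    using C by (intro UN_least) (auto simp: square_codes_def word_fibre_def digit_words_def)
  have val: "measure \<mu> (S_word n m w -` ?A) = (if w \<in> ?F then 1 else 0)" if w: "w \<in> ?W" for w
  proof (cases "w \<in> ?F")
    case True
    then obtain x y where xy: "(x, y) \<in> C" "w \<in> word_fibre D x y" by auto
    then have "{0..1} \<times> {0..1} \<subseteq> S_word n m w -` Q_set n m x y"
      using C by (intro S_word_vimage_square_superset) auto
    also have "\<dots> \<subseteq> S_word n m w -` ?A" using xy(1) by (intro vimage_mono) auto
    finally have "E \<subseteq> S_word n m w -` ?A" using E_subset_unit_square by (rule subset_trans [rotated])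
    then show ?thesis using True measure_superset_E [OF vimage_borel(2) [OF A]] by simp
  next
    case False
    have "measure \<mu> (S_word n m w -` ?A) = measure \<mu> (\<Union>c\<in>C. S_word n m w -` (case c of (x, y) \<Rightarrow> Q_set n m x y))"
      by (simp add: vimage_UN)
    also have "\<dots> \<le> (\<Sum>c\<in>C. measure \<mu> (S_word n m w -` (case c of (x, y) \<Rightarrow> Q_set n m x y)))"
      using fin vimage_borel(2) Q_set_borel
      by (intro finite_measure_subadditive_finite) (auto split: prod.split)
    also have "\<dots> = 0"
      using False w C
      by (intro sum.neutral) (auto intro!: measure_S_word_vimage_square_eq_0)
    finally show ?thesis using False by (simp add: measure_le_0_iff)
  qed
  have lenC: "length x = k" if "(x, y) \<in> C" for x y
    using that C by (auto simp: square_codes_def)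
  have "card ?F = (\<Sum>c\<in>C. card (case c of (x, y) \<Rightarrow> word_fibre D x y))"
  proof (rule card_UN_disjoint)
    show "\<forall>c\<in>C. \<forall>c'\<in>C. c \<noteq> c' \<longrightarrow> (case c of (x, y) \<Rightarrow> word_fibre D x y) \<inter>
        (case c' of (x, y) \<Rightarrow> word_fibre D x y) = {}"
      by (auto simp: word_fibre_def) (metis lenC)
  qed (use fin finite_word_fibre in auto)
  also have "\<dots> = (\<Sum>(x, y)\<in>C. row_weight D (drop k y))"
    using C by (intro sum.cong) (auto simp: card_code_fibre)
  finally have cardF: "card ?F = (\<Sum>(x, y)\<in>C. row_weight D (drop k y))" .
  have "(\<Sum>w\<in>?W. measure \<mu> (S_word n m w -` ?A)) = (\<Sum>w\<in>?W. if w \<in> ?F then 1 else 0)"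
    using val by (intro sum.cong) auto
  also have "\<dots> = real (card (?W \<inter> ?F))"
    using finite_digit_words [OF finite_D] by (subst sum.inter_restrict [symmetric]) auto
  also have "?W \<inter> ?F = ?F" using FW by blast
  finally show ?thesis
    using measure_words [OF A, of "ell n m k"] cardF by simp
qed

lemma measure_square:
  assumes "(x, y) \<in> square_codes n m D k"
  shows "measure \<mu> (Q_set n m x y) = real (row_weight D (drop k y)) / real (card D) ^ ell n m k"
  using measure_Union_squares [of "{(x, y)}" k] assms by simp

section \<open>Consequences of doubling\<close>

lemma measure_Int_E:
  assumes "A \<in> sets borel"
  shows "measure \<mu> (E \<inter> A) = measure \<mu> A"
proof -
  interpret finite_measure \<mu> by (rule finite_measure_mu)
  have "measure \<mu> ((E \<inter> A) \<union> (A - E)) = measure \<mu> (E \<inter> A) + measure \<mu> (A - E)"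
    using assms E_borel by (intro finite_measure_Union) auto
  moreover have "(E \<inter> A) \<union> (A - E) = A" by blast
  ultimately show ?thesis using assms E_borel measure_disjoint_E [of "A - E"] by auto
qed

lemma doubling_iterated:
  assumes "doubling_on E \<mu>"
  obtains C where "C \<ge> 1"
    "\<And>z r p. z \<in> E \<Longrightarrow> r > 0 \<Longrightarrow>
      measure \<mu> (E \<inter> ball z (2 ^ p * r)) \<le> C ^ p * measure \<mu> (E \<inter> ball z r)"
proof -
  interpret finite_measure \<mu> by (rule finite_measure_mu)
  obtain C :: real where C: "C \<ge> 1"
    "\<And>z r. z \<in> E \<Longrightarrow> r > 0 \<Longrightarrow>
      emeasure \<mu> (E \<inter> ball z (2 * r)) \<le> ennreal C * emeasure \<mu> (E \<inter> ball z r)"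
    using assms unfolding doubling_on_def by blast
  have step: "measure \<mu> (E \<inter> ball z (2 * r)) \<le> C * measure \<mu> (E \<inter> ball z r)" if "z \<in> E" "r > 0" for z r
    using C(2) [OF that] C(1) by (simp add: emeasure_eq_measure ennreal_mult [symmetric])
  have "measure \<mu> (E \<inter> ball z (2 ^ p * r)) \<le> C ^ p * measure \<mu> (E \<inter> ball z r)"
    if z: "z \<in> E" and r: "r > 0" for z r p
  proof (induction p)
    case (Suc p)
    have "measure \<mu> (E \<inter> ball z (2 ^ Suc p * r)) \<le> C * measure \<mu> (E \<inter> ball z (2 ^ p * r))"
      using step [OF z, of "2 ^ p * r"] r by (simp add: mult.assoc)
    also have "\<dots> \<le> C * (C ^ p * measure \<mu> (E \<inter> ball z r))"
      using Suc C(1) by (intro mult_left_mono) auto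
    finally show ?case by (simp add: mult.assoc)
  qed simp
  with C(1) show thesis using that by blast
qed

lemma S_word_E: "set w \<subseteq> D \<Longrightarrow> z \<in> E \<Longrightarrow> S_word n m w z \<in> E"
proof (induction w)
  case (Cons d w)
  then have "S_map n m d (S_word n m w z) \<in> (\<Union>d\<in>D. S_map n m d ` E)" by auto
  then show ?case using E_fixed by (simp add: S_word_Cons)
qed (simp add: S_word_Nil)

text \<open>Appending the two row digits \<open>0\<close> and \<open>m - 1\<close> keeps a point away from both horizontal sides of
  its approximate square.\<close>

lemma exists_vertically_inner_point:
  assumes code: "(x, y) \<in> square_codes n m D k" and rows: "0 \<in> snd ` D" "m - 1 \<in> snd ` D"
  obtains z where "z \<in> E" "z \<in> Q_set n m x y"
    "real (digit_value m y) * real m ^ 2 + 1 \<le> snd z * real m ^ (ell n m k + 2)"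
    "snd z * real m ^ (ell n m k + 2) \<le> real (digit_value m y) * real m ^ 2 + real m ^ 2 - 1"
proof -
  let ?L = "ell n m k"
  have len: "length x = k" "length y = ?L" and dr: "set (drop k y) \<subseteq> nonvacant_rows m D"
    using code by (auto simp: square_codes_def)
  have "card (word_fibre D x y) > 0"
    using card_code_fibre [OF code] row_weight_pos [OF dr] by simp
  then obtain w where w: "w \<in> word_fibre D x y" by (metis all_not_in_conv card.empty less_irrefl)
  then have w': "set w \<subseteq> D" "map snd w = y" "length w = ?L"
    using len by (auto simp: word_fibre_def)
  obtain d0 d1 where d: "d0 \<in> D" "snd d0 = 0" "d1 \<in> D" "snd d1 = m - 1" using rows by force
  obtain e where e: "e \<in> E" using E_nonempty by blast
  define z' where "z' = S_word n m [d0, d1] e"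
  define z where "z = S_word n m w z'"
  have z'E: "z' \<in> E" unfolding z'_def using d e by (intro S_word_E) auto
  have "z \<in> E" unfolding z_def using w' z'E by (intro S_word_E)
  moreover have "z \<in> Q_set n m x y"
    using S_word_vimage_square_superset [OF code w] z'E E_subset_unit_square unfolding z_def by blast
  moreover have "snd z' * real m ^ 2 = real (m - 1) + snd e"
    using S_word_coordinates(2) [OF n_pos m_pos, of "[d0, d1]" e] d
    by (simp add: z'_def digit_value_Cons power2_eq_square)
  then have z'2: "1 \<le> snd z' * real m ^ 2" "snd z' * real m ^ 2 \<le> real m"
    using e E_subset_unit_square m_ge_2 by auto
  have "2 * real m \<le> real m ^ 2" using m_ge_2 by (simp add: power2_eq_square)
  with m_ge_2 z'2 have z'3: "snd z' * real m ^ 2 \<le> real m ^ 2 - 1" by linarith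
  have "snd z * real m ^ ?L = real (digit_value m y) + snd z'"
    using S_word_coordinates(2) [OF n_pos m_pos, of w z'] w' unfolding z_def by simp
  then have "snd z * real m ^ (?L + 2) = real (digit_value m y) * real m ^ 2 + snd z' * real m ^ 2"
    by (simp only: power_add mult.assoc [symmetric] distrib_right)
  ultimately show thesis using that [of z] z'2 z'3 by simp
qed

text \<open>For fixed rows \<open>y\<close> and a fixed column of width \<open>n ^ -k\<close> the words form a fibre or there are none, even if no
  approximate square lies at that place.\<close>

lemma card_column_words_le:
  assumes y: "length y = L" and k: "k \<le> L"
  shows "card {w \<in> digit_words D L. map snd w = y \<and> digit_value n (take k (map fst w)) = v}
    \<le> row_weight D (drop k y)" (is "card ?T \<le> _")
proof (cases "?T = {}")
  case False
  then obtain w1 where w1: "w1 \<in> ?T" by blast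
  let ?x = "take k (map fst w1)"
  have set_x: "set (take k (map fst w)) \<subseteq> {0..<n}" if "set w \<subseteq> D" for w
    using that D_bounds set_take_subset [of k "map fst w"] by fastforce
  have lenx: "length ?x = k" using w1 k by (auto simp: digit_words_def)
  have "?T \<subseteq> word_fibre D ?x y"
  proof
    fix w assume w: "w \<in> ?T"
    have "take k (map fst w) = ?x"
      using w w1 set_x k by (intro digit_value_inj [of _ _ n]) (auto simp: digit_words_def)
    then show "w \<in> word_fibre D ?x y" using w lenx by (auto simp: word_fibre_def digit_words_def)
  qed
  then have "card ?T \<le> card (word_fibre D ?x y)" by (rule card_mono [OF finite_word_fibre])
  also have "\<dots> = row_weight D (drop k y)"
  proof -
    have "zip (take k (map fst w)) (map snd w) = take k w" for w :: "(nat \<times> nat) list"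
      by (induction w arbitrary: k) (auto simp: take_Cons split: nat.split)
    then have "zip ?x y = take k w1" using w1 by auto
    then have "set (zip ?x y) \<subseteq> D"
      using w1 set_take_subset [of k w1] by (auto simp: digit_words_def)
    then show ?thesis using card_word_fibre [OF finite_D, of ?x y] lenx y k by simp
  qed
  finally show ?thesis .
qed (simp only: card.empty le0)

text \<open>A ball around such an inner point reaches no other row of approximate squares, and in its
  row at most three columns; approximate squares of one row have equal measure.\<close>

lemma measure_small_ball_le:
  assumes code: "(x, y) \<in> square_codes n m D k"
    and z: "z \<in> Q_set n m x y"
    "real (digit_value m y) * real m ^ 2 + 1 \<le> snd z * real m ^ (ell n m k + 2)"
    "snd z * real m ^ (ell n m k + 2) \<le> real (digit_value m y) * real m ^ 2 + real m ^ 2 - 1"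
  shows "measure \<mu> (E \<inter> ball z (1 / real m ^ (ell n m k + 2)))
    \<le> 3 * real (row_weight D (drop k y)) / real (card D) ^ ell n m k"
proof -
  interpret finite_measure \<mu> by (rule finite_measure_mu)
  let ?L = "ell n m k"
  let ?r = "1 / real m ^ (?L + 2)"
  let ?A = "E \<inter> ball z ?r"
  let ?X = "digit_value n x"
  let ?T = "\<lambda>v. {w \<in> digit_words D ?L. map snd w = y \<and> digit_value n (take k (map fst w)) = v}"
  let ?U = "\<Union>v\<in>{?X - 1, ?X, ?X + 1}. ?T v"
  have len: "length x = k" "length y = ?L" using code by (auto simp: square_codes_def)
  have A: "?A \<in> sets borel" using E_borel by auto
  have mpos: "real m ^ t > 0" for t using m_pos by simp
  have "n ^ k < m ^ (?L + 2)"
    using ell_power_less [OF m_ge_2 m_less_n, of k] m_pos by (simp add: less_le_trans)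
  then have nm: "real n ^ k < real m ^ (?L + 2)" by (metis of_nat_less_iff of_nat_power)
  \<comment> \<open>A rectangle that meets the ball has rows exactly \<open>y\<close>, because the inner point is farther than the radius
    from the horizontal edges, and a column at most one step away, because the radius is less than
    the width.\<close>
  have in_U: "w \<in> ?U" if w: "w \<in> digit_words D ?L" and e: "e \<in> E" "S_word n m w e \<in> ball z ?r" for w e
  proof -
    let ?p = "S_word n m w e"
    have e01: "0 \<le> fst e" "fst e \<le> 1" "0 \<le> snd e" "snd e \<le> 1"
      using e E_subset_unit_square by (auto simp: mem_Times_iff)
    have w': "length w = ?L" "set w \<subseteq> D" using w by (auto simp: digit_words_def)
    have d: "\<bar>fst z - fst ?p\<bar> < ?r" "\<bar>snd z - snd ?p\<bar> < ?r"
      using e(2) dist_fst_le [of z ?p] dist_snd_le [of z ?p] by (auto simp: dist_real_def)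
    have "\<bar>snd z - snd ?p\<bar> * real m ^ (?L + 2) < 1"
      using d(2) mpos [of "?L + 2"] by (simp add: less_divide_eq)
    then have "\<bar>snd z * real m ^ (?L + 2) - snd ?p * real m ^ (?L + 2)\<bar> < 1"
      using mpos [of "?L + 2"] by (metis abs_mult abs_of_pos left_diff_distrib)
    moreover have "snd ?p * real m ^ (?L + 2) = (real (digit_value m (map snd w)) + snd e) * real m ^ 2"
      using S_word_coordinates(2) [OF n_pos m_pos, of w e] w'
      by (simp only: power_add mult.assoc [symmetric])
    ultimately have "real (digit_value m y) * real m ^ 2 < (real (digit_value m (map snd w)) + snd e) * real m ^ 2"
      "(real (digit_value m (map snd w)) + snd e) * real m ^ 2 < (real (digit_value m y) + 1) * real m ^ 2"
      using z(2,3) by (auto simp: distrib_right)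
    then have "real (digit_value m y) < real (digit_value m (map snd w)) + snd e"
      "real (digit_value m (map snd w)) + snd e < real (digit_value m y) + 1"
      using mpos [of 2] by (auto simp: mult_less_cancel_right)
    with e01 have "real (digit_value m y) < real (digit_value m (map snd w)) + 1"
      "real (digit_value m (map snd w)) < real (digit_value m y) + 1"
      by linarith+
    then have "digit_value m (map snd w) = digit_value m y" by linarith
    then have 1: "map snd w = y"
      using w' D_bounds len square_codes_set(4) [OF code]
      by (intro digit_value_inj [of _ _ m]) auto
    obtain r where r: "fst ?p * real n ^ k =
          real (digit_value n (take k (map fst w))) + (r + fst e) / real n ^ (?L - k)"
        "0 \<le> r" "r + 1 \<le> real n ^ (?L - k)"
      using fst_S_word_prefix [OF w k_le_ell, of e] by auto
    let ?s = "(r + fst e) / real n ^ (?L - k)"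
    have s: "0 \<le> ?s" "?s \<le> 1" using e01 r n_pos by (auto simp: divide_le_eq)
    have "\<bar>fst z - fst ?p\<bar> * real n ^ k \<le> ?r * real n ^ k"
      using d(1) by (intro mult_right_mono) auto
    also have "\<dots> < 1" using nm mpos [of "?L + 2"] by (simp add: divide_less_eq)
    finally have "\<bar>fst z * real n ^ k - fst ?p * real n ^ k\<bar> < 1"
      by (metis abs_mult abs_of_nat left_diff_distrib of_nat_power)
    then have "real (digit_value n (take k (map fst w))) < real ?X + 2"
      "real ?X < real (digit_value n (take k (map fst w))) + 2"
      using r(1) s z(1) len by (auto simp: mem_Q_set_iff [OF n_pos m_pos])
    then have "digit_value n (take k (map fst w)) \<in> {?X - 1, ?X, ?X + 1}" by auto
    with 1 w show ?thesis by blast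
  qed
  have finU: "finite ?U" using finite_digit_words [OF finite_D] by auto
  have "measure \<mu> (S_word n m w -` ?A) \<le> (if w \<in> ?U then 1 else 0)" if w: "w \<in> digit_words D ?L" for w
  proof (cases "w \<in> ?U")
    case False
    then have "(S_word n m w -` ?A) \<inter> E = {}" using in_U [OF w] by blast
    then show ?thesis using measure_disjoint_E [OF vimage_borel(2) [OF A]] by simp
  next
    case True
    then show ?thesis using finite_measure_mono [of "S_word n m w -` ?A" UNIV] by simp
  qed
  then have "(\<Sum>w\<in>digit_words D ?L. measure \<mu> (S_word n m w -` ?A))
      \<le> (\<Sum>w\<in>digit_words D ?L. if w \<in> ?U then 1 else 0)"
    by (intro sum_mono)
  also have "\<dots> = real (card (digit_words D ?L \<inter> ?U))"
    using finite_digit_words [OF finite_D] by (subst sum.inter_restrict [symmetric]) auto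
  also have "\<dots> \<le> real (card ?U)" using finU by (intro of_nat_mono card_mono) auto
  also have "card ?U \<le> (\<Sum>v\<in>{?X - 1, ?X, ?X + 1}. card (?T v))" by (intro card_UN_le) auto
  also have "\<dots> \<le> (\<Sum>v\<in>{?X - 1, ?X, ?X + 1}. row_weight D (drop k y))"
    using card_column_words_le [OF len(2) k_le_ell] by (intro sum_mono) auto
  also have "\<dots> \<le> 3 * row_weight D (drop k y)"
    using card_insert_le_m1 [of 3 "{?X, ?X + 1}" "?X - 1"] by (simp add: card_insert_if)
  finally have "(\<Sum>w\<in>digit_words D ?L. measure \<mu> (S_word n m w -` ?A)) \<le> 3 * real (row_weight D (drop k y))"
    by simp
  then show ?thesis
    using measure_words [OF A, of ?L] card_D_pos by (simp add: divide_right_mono)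
qed

text \<open>A ball of radius \<open>r\<close> around an inner point of \<open>Q(x, y)\<close> has measure at most three times that of
  \<open>Q(x, y)\<close>, and a bounded number of doublings of \<open>r\<close> makes the ball contain a vertical neighbour of \<open>Q(x, y)\<close>.
  So the weights of vertical neighbours are comparable, uniformly in the rank.\<close>

lemma doubling_weight_le:
  assumes doubling: "doubling_on E \<mu>" and rows: "0 \<in> snd ` D" "m - 1 \<in> snd ` D"
  obtains K :: real where "\<And>k x y y'. (x, y) \<in> square_codes n m D k \<Longrightarrow> (x, y') \<in> square_codes n m D k \<Longrightarrow>
    digit_value m y' \<le> digit_value m y + 1 \<Longrightarrow> digit_value m y \<le> digit_value m y' + 1 \<Longrightarrow>
    real (row_weight D (drop k y')) \<le> K * real (row_weight D (drop k y))"
proof -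
  interpret finite_measure \<mu> by (rule finite_measure_mu)
  obtain C where C: "C \<ge> 1"
    "\<And>z r p. z \<in> E \<Longrightarrow> r > 0 \<Longrightarrow>
      measure \<mu> (E \<inter> ball z (2 ^ p * r)) \<le> C ^ p * measure \<mu> (E \<inter> ball z r)"
    using doubling_iterated [OF doubling] by blast
  \<comment> \<open>The neighbour lies within \<open>3 m\<close> to the power \<open>-\<ell>\<close> of the inner point, which is \<open>p\<close> times
    the small radius, and \<open>p < 2 ^ p\<close>.\<close>
  define p where "p = 3 * m ^ 2"
  have "real (row_weight D (drop k y')) \<le> (3 * C ^ p) * real (row_weight D (drop k y))"
    if code: "(x, y) \<in> square_codes n m D k" and code': "(x, y') \<in> square_codes n m D k"
      and near: "digit_value m y' \<le> digit_value m y + 1" "digit_value m y \<le> digit_value m y' + 1"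
    for k x y y'
  proof -
    let ?L = "ell n m k"
    let ?r = "1 / real m ^ (?L + 2)"
    have len: "length x = k" "length y = ?L" "length y' = ?L"
      using code code' by (auto simp: square_codes_def)
    obtain z where z: "z \<in> E" "z \<in> Q_set n m x y"
      "real (digit_value m y) * real m ^ 2 + 1 \<le> snd z * real m ^ (ell n m k + 2)"
      "snd z * real m ^ (ell n m k + 2) \<le> real (digit_value m y) * real m ^ 2 + real m ^ 2 - 1"
      using exists_vertically_inner_point [OF code rows] by blast
    have mpos: "real m ^ t > 0" "real n ^ t > 0" for t using m_pos n_pos by auto
    have mn: "real m ^ ?L \<le> real n ^ k"
      using ell_power_le [OF m_ge_2 m_less_n, of k] by (metis of_nat_le_iff of_nat_power)
    have "Q_set n m x y' \<subseteq> ball z (2 ^ p * ?r)"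
    proof
      fix q assume q: "q \<in> Q_set n m x y'"
      have "\<bar>fst z * real n ^ k - fst q * real n ^ k\<bar> \<le> 1"
        using z(2) q len by (auto simp: mem_Q_set_iff [OF n_pos m_pos])
      then have "\<bar>fst z - fst q\<bar> * real n ^ k \<le> 1"
        using mpos(2) [of k] by (metis abs_mult abs_of_pos left_diff_distrib)
      then have "\<bar>fst z - fst q\<bar> * real m ^ ?L \<le> 1"
        using mn by (meson abs_ge_zero mult_left_mono order_trans)
      then have f: "\<bar>fst z - fst q\<bar> \<le> 1 / real m ^ ?L" using mpos(1) [of ?L] by (simp add: le_divide_eq)
      have "\<bar>snd z * real m ^ ?L - snd q * real m ^ ?L\<bar> \<le> 2"
        using z(2) q len near by (auto simp: mem_Q_set_iff [OF n_pos m_pos])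
      then have "\<bar>snd z - snd q\<bar> * real m ^ ?L \<le> 2"
        using mpos(1) [of ?L] by (metis abs_mult abs_of_pos left_diff_distrib)
      then have s: "\<bar>snd z - snd q\<bar> \<le> 2 / real m ^ ?L" using mpos(1) [of ?L] by (simp add: le_divide_eq)
      have "dist z q \<le> \<bar>fst z - fst q\<bar> + \<bar>snd z - snd q\<bar>"
        unfolding dist_prod_def dist_real_def
        using sqrt_sum_squares_le_sum_abs [of "\<bar>fst z - fst q\<bar>" "\<bar>snd z - snd q\<bar>"] by simp
      also have "\<dots> \<le> 3 / real m ^ ?L" using f s by (simp add: add_divide_distrib [symmetric])
      also have "\<dots> = real p * ?r" using m_pos
        by (simp only: p_def power_add of_nat_mult of_nat_power) (simp add: power2_eq_square)
      also have "\<dots> < 2 ^ p * ?r"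
        using mpos(1) [of "?L + 2"] of_nat_less_two_power [of p] by (intro mult_strict_right_mono) auto
      finally show "q \<in> ball z (2 ^ p * ?r)" by simp
    qed
    then have "measure \<mu> (E \<inter> Q_set n m x y') \<le> measure \<mu> (E \<inter> ball z (2 ^ p * ?r))"
      using E_borel by (intro finite_measure_mono) auto
    also have "\<dots> \<le> C ^ p * measure \<mu> (E \<inter> ball z ?r)"
      using mpos(1) [of "?L + 2"] by (intro C(2) z(1)) (simp only: zero_less_divide_1_iff)
    also have "\<dots> \<le> C ^ p * (3 * real (row_weight D (drop k y)) / real (card D) ^ ?L)"
      using measure_small_ball_le [OF code z(2-4)] C(1) by (intro mult_left_mono) auto
    finally have "real (row_weight D (drop k y')) / real (card D) ^ ?L
        \<le> C ^ p * (3 * real (row_weight D (drop k y)) / real (card D) ^ ?L)"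
      by (simp add: measure_Int_E Q_set_borel measure_square [OF code'])
    then show ?thesis using card_D_pos by (simp add: field_simps)
  qed
  then show thesis using that by blast
qed

lemma square_code_extend:
  assumes "d \<in> D" "length v + k = ell n m k" "set v \<subseteq> snd ` D"
  shows "(replicate k (fst d), replicate k (snd d) @ v) \<in> square_codes n m D k"
proof -
  have "zip (replicate k a) (replicate k b @ v) = replicate k (a, b)" for a b :: nat
    by (induction k) auto
  then show ?thesis using assms nonvacant_iff by (auto simp: square_codes_def)
qed

text \<open>Two vertically adjacent words that differ in a carry along \<open>s\<close> trailing digits have weights
  whose ratio is proportional to the \<open>s\<close>-th power of the ratio of the two extreme row counts;
  \<open>s\<close> can be made arbitrarily large, so a doubling measure forces these counts to be equal.\<close>

lemma doubling_extreme_rows_le: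
  assumes doubling: "doubling_on E \<mu>"
    and rows: "c \<in> snd ` D" "c' \<in> snd ` D" "e \<in> snd ` D" "e' \<in> snd ` D"
    and adj: "c' = Suc c \<and> e = m - 1 \<and> e' = 0 \<or> c = Suc c' \<and> e = 0 \<and> e' = m - 1"
  shows "row_count D e' \<le> row_count D e"
proof (rule ccontr)
  assume less: "\<not> row_count D e' \<le> row_count D e"
  have rows': "0 \<in> snd ` D" "m - 1 \<in> snd ` D" using rows(3,4) adj by (elim disjE; simp)+
  obtain K :: real where K: "\<And>k x y y'. (x, y) \<in> square_codes n m D k \<Longrightarrow> (x, y') \<in> square_codes n m D k \<Longrightarrow>
    digit_value m y' \<le> digit_value m y + 1 \<Longrightarrow> digit_value m y \<le> digit_value m y' + 1 \<Longrightarrow>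
    real (row_weight D (drop k y')) \<le> K * real (row_weight D (drop k y))"
    using doubling_weight_le [OF doubling rows'] by blast
  have pos: "row_count D j > 0" if "j \<in> snd ` D" for j
    using that nonvacant_iff [of j] by (auto simp: nonvacant_rows_def)
  let ?q = "real (row_count D e') / real (row_count D e)"
  have q: "1 < ?q" using less pos [OF rows(3)] by simp
  obtain s0 where s0: "K * real (row_count D c) < ?q ^ s0" using real_arch_pow [OF q] by blast
  obtain k where k: "k + (s0 + 1) \<le> ell n m k" using ell_minus_unbounded [OF m_ge_2 m_less_n] by blast
  define s where "s = ell n m k - k - 1"
  have s: "s0 \<le> s" "Suc s + k = ell n m k" using k by (auto simp: s_def)
  obtain d where d: "d \<in> D" using rows by blast
  \<comment> \<open>The first \<open>k\<close> digits only have to be admissible; the carry takes place after position \<open>k\<close>,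
    where every row counts.\<close>
  let ?x = "replicate k (fst d)" and ?u = "replicate k (snd d)"
  let ?y = "?u @ [c] @ replicate s e" and ?y' = "?u @ [c'] @ replicate s e'"
  have codes: "(?x, ?y) \<in> square_codes n m D k" "(?x, ?y') \<in> square_codes n m D k"
    using d s(2) rows by (intro square_code_extend; simp add: set_replicate_conv_if)+
  have "digit_value m ?y' \<le> digit_value m ?y + 1 \<and> digit_value m ?y \<le> digit_value m ?y' + 1"
    using adj digit_value_carry [OF m_pos, of ?u c s] digit_value_carry [OF m_pos, of ?u c' s] by auto
  then have "real (row_weight D (drop k ?y')) \<le> K * real (row_weight D (drop k ?y))"
    using K [OF codes] by blast
  then have "real (row_count D c') * real (row_count D e') ^ s \<le> K * (real (row_count D c) * real (row_count D e) ^ s)"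
    by simp
  then have "real (row_count D c') * ?q ^ s \<le> K * real (row_count D c)"
    using pos [OF rows(3)] by (simp add: power_divide field_simps)
  moreover have "?q ^ s0 \<le> ?q ^ s" using q s by (intro power_increasing) auto
  moreover have "1 * ?q ^ s \<le> real (row_count D c') * ?q ^ s"
    using pos [OF rows(2)] q by (intro mult_right_mono) auto
  ultimately show False using s0 by linarith
qed

text \<open>The two inequalities come from comparing the pair of neighbours in both directions.\<close>

lemma doubling_extreme_rows_eq:
  assumes "doubling_on E \<mu>" "c \<in> snd ` D" "Suc c \<in> snd ` D" "0 \<in> snd ` D" "m - 1 \<in> snd ` D"
  shows "row_count D 0 = row_count D (m - 1)"
  using doubling_extreme_rows_le [OF assms(1), of c "Suc c" "m - 1" 0]
    doubling_extreme_rows_le [OF assms(1), of "Suc c" c 0 "m - 1"] assms by auto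

section \<open>Components\<close>

definition codes_in :: "nat \<Rightarrow> (real \<times> real) set \<Rightarrow> (nat list \<times> nat list) set" where
  "codes_in k U = {(x, y) \<in> square_codes n m D k. Q_set n m x y \<subseteq> U}"

lemma codes_in_subset: "codes_in k U \<subseteq> square_codes n m D k"
  by (auto simp: codes_in_def)

lemma finite_codes_in: "finite (codes_in k U)"
  using codes_in_subset finite_square_codes by (rule finite_subset)

lemma connected_Q_set: "connected (Q_set a b x y)"
  unfolding Q_set_def by (intro connected_Times) auto

lemma Q_set_corner: "(real (digit_value n x) / real n ^ length x, real (digit_value m y) / real m ^ length y)
    \<in> Q_set n m x y"
  using n_pos m_pos by (simp add: mem_Q_set_iff)

lemma Q_set_subset_component:
  assumes "U \<in> components S" "Q_set n m x y \<subseteq> S" "Q_set n m x y \<inter> U \<noteq> {}"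
  shows "Q_set n m x y \<subseteq> U"
  using components_maximal [OF assms(1) connected_Q_set assms(2)] assms(3) by blast

lemma square_subset_E_approx:
  "(x, y) \<in> square_codes n m D k \<Longrightarrow> Q_set n m x y \<subseteq> E_approx n m D k"
  unfolding E_approx_def approx_squares_eq by auto

lemma square_meeting_component:
  assumes "U \<in> components (E_approx n m D k)" "(x, y) \<in> square_codes n m D k"
    and "Q_set n m x y \<inter> U \<noteq> {}"
  shows "(x, y) \<in> codes_in k U"
  using Q_set_subset_component [OF assms(1) square_subset_E_approx [OF assms(2)] assms(3)] assms(2)
  by (simp add: codes_in_def)

lemma mem_componentE:
  assumes U: "U \<in> components (E_approx n m D k)" and p: "p \<in> U"
  obtains x y where "(x, y) \<in> codes_in k U" "p \<in> Q_set n m x y"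
proof -
  have "p \<in> E_approx n m D k" using in_components_subset [OF U] p by auto
  then obtain x y where xy: "(x, y) \<in> square_codes n m D k" "p \<in> Q_set n m x y"
    unfolding E_approx_def approx_squares_eq by auto
  with p have "(x, y) \<in> codes_in k U" by (intro square_meeting_component [OF U]) auto
  with xy show thesis using that by blast
qed

lemma component_eq_Union:
  assumes U: "U \<in> components (E_approx n m D k)"
  shows "U = (\<Union>(x, y)\<in>codes_in k U. Q_set n m x y)"
proof
  show "U \<subseteq> (\<Union>(x, y)\<in>codes_in k U. Q_set n m x y)"
    by (rule subsetI, erule mem_componentE [OF U]) auto
qed (auto simp: codes_in_def)

lemma codes_in_nonempty:
  assumes U: "U \<in> components (E_approx n m D k)"
  shows "codes_in k U \<noteq> {}"
proof -
  obtain p where "p \<in> U" using in_components_nonempty [OF U] by blast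
  then show ?thesis by (rule mem_componentE [OF U]) auto
qed

text \<open>The vertical projection of a component is an interval, so it contains the midpoint of every \<open>m\<close>-adic
  interval between two that occur; a midpoint belongs to one interval only.\<close>

lemma component_row_convex:
  assumes U: "U \<in> components (E_approx n m D k)"
    and c1: "(x1, y1) \<in> codes_in k U" and c2: "(x2, y2) \<in> codes_in k U"
    and Z: "digit_value m y1 < Z" "Z < digit_value m y2"
  obtains x y where "(x, y) \<in> codes_in k U" "digit_value m y = Z"
proof -
  let ?L = "ell n m k"
  have mpos: "real m ^ ?L > 0" using m_pos by simp
  have len: "length y = ?L" if "(x, y) \<in> codes_in k U" for x y
    using that by (auto simp: codes_in_def square_codes_def)
  have "connected (snd ` U)"
    by (intro connected_continuous_image continuous_intros in_components_connected [OF U])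
  then have int: "is_interval (snd ` U)" by (simp add: is_interval_connected_1)
  have ends: "real (digit_value m y) / real m ^ ?L \<in> snd ` U" if "(x, y) \<in> codes_in k U" for x y
    using Q_set_corner [of x y] that len [OF that] by (force simp: codes_in_def)
  let ?t = "(real Z + 1 / 2) / real m ^ ?L"
  have "real (digit_value m y1) / real m ^ ?L \<le> ?t" "?t \<le> real (digit_value m y2) / real m ^ ?L"
    using Z mpos by (auto intro!: divide_right_mono)
  then have "?t \<in> snd ` U"
    using int ends [OF c1] ends [OF c2] unfolding is_interval_1 by blast
  then obtain p where p: "p \<in> U" "snd p = ?t" by auto
  then obtain x y where xy: "(x, y) \<in> codes_in k U" "p \<in> Q_set n m x y"
    using mem_componentE [OF U] by blast
  have "snd p * real m ^ ?L = real Z + 1 / 2" using p mpos by simp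
  then have "real (digit_value m y) \<le> real Z + 1 / 2" "real Z + 1 / 2 \<le> real (digit_value m y) + 1"
    using xy(2) len [OF xy(1)] by (auto simp: mem_Q_set_iff [OF n_pos m_pos])
  then have "digit_value m y = Z" by linarith
  with xy(1) show thesis using that by blast
qed

lemma digit_value_mod_not_vacant:
  assumes "(x, y) \<in> square_codes n m D k" "k \<ge> 1" "row_count D j0 = 0"
  shows "digit_value m y mod m \<noteq> j0"
proof -
  have len: "length y = ell n m k" using assms(1) by (auto simp: square_codes_def)
  then obtain w b where y: "y = w @ [b]"
    using k_le_ell [of k] assms(2) by (cases y rule: rev_cases) auto
  have b: "b \<in> snd ` D" using square_codes_set(2) [OF assms(1)] y by auto
  then have "b < m" using D_bounds by auto
  moreover have "row_count D b > 0" using b nonvacant_iff [of b] by (auto simp: nonvacant_rows_def)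
  ultimately show ?thesis using assms(3) y by auto
qed

text \<open>The row index of an approximate square never ends in the vacant digit \<open>j0\<close>, and the row
  indices in a component leave no gaps. So they lie strictly between two consecutive integers that
  end in \<open>j0\<close>. Adding \<open>m - 1 - j0\<close> turns the final digit \<open>j0\<close> into \<open>m - 1\<close>, so that these gaps become
  the blocks of a division by \<open>m\<close> and the lower end needs no negative integer.\<close>

lemma component_rows_same_block:
  assumes U: "U \<in> components (E_approx n m D k)" and k: "k \<ge> 1"
    and vacant: "row_count D j0 = 0" "j0 < m"
    and c1: "(x1, y1) \<in> codes_in k U" and c2: "(x2, y2) \<in> codes_in k U"
  shows "(digit_value m y1 + (m - 1 - j0)) div m = (digit_value m y2 + (m - 1 - j0)) div m"
proof -
  have le: "(digit_value m y' + (m - 1 - j0)) div m \<le> (digit_value m y + (m - 1 - j0)) div m"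
    if c: "(x, y) \<in> codes_in k U" and c': "(x', y') \<in> codes_in k U" for x y x' y'
  proof (rule ccontr)
    let ?g = "(digit_value m y + (m - 1 - j0)) div m" and ?g' = "(digit_value m y' + (m - 1 - j0)) div m"
    assume "\<not> ?g' \<le> ?g"
    then have "Suc ?g \<le> ?g'" by simp
    \<comment> \<open>The integer ending in \<open>j0\<close> that separates the two blocks.\<close>
    define Z where "Z = ?g * m + j0"
    have "digit_value m y + (m - 1 - j0) < ?g * m + m"
      using m_pos dividend_less_div_times [of m "digit_value m y + (m - 1 - j0)"] by simp
    then have 1: "digit_value m y \<le> Z" using vacant by (simp add: Z_def)
    have "Suc ?g * m \<le> ?g' * m" using \<open>Suc ?g \<le> ?g'\<close> by (rule mult_le_mono1)
    also have "\<dots> \<le> digit_value m y' + (m - 1 - j0)" by simp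
    finally have 2: "Z < digit_value m y'" using vacant by (simp add: Z_def)
    have 3: "Z mod m = j0" using vacant by (simp add: Z_def)
    have "digit_value m y mod m \<noteq> j0"
      using c codes_in_subset by (intro digit_value_mod_not_vacant [OF _ k vacant(1)]) blast
    with 1 3 have "digit_value m y < Z" by (metis le_neq_implies_less)
    then obtain a b where ab: "(a, b) \<in> codes_in k U" "digit_value m b = Z"
      using component_row_convex [OF U c c' _ 2] by blast
    have "digit_value m b mod m \<noteq> j0"
      using ab(1) codes_in_subset by (intro digit_value_mod_not_vacant [OF _ k vacant(1)]) blast
    with ab(2) 3 show False by simp
  qed
  show ?thesis using le [OF c1 c2] le [OF c2 c1] by simp
qed

text \<open>Within one block the shifted last digit identifies a row index, and it is never \<open>m - 1\<close>.\<close>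

lemma card_component_rows_le:
  assumes U: "U \<in> components (E_approx n m D k)" and k: "k \<ge> 1"
    and vacant: "row_count D j0 = 0" "j0 < m"
  shows "card ((\<lambda>(x, y). digit_value m y) ` codes_in k U) \<le> m - 1" (is "card ?Y \<le> _")
proof -
  let ?h = "\<lambda>Y. (Y + (m - 1 - j0)) mod m"
  have "inj_on ?h ?Y"
  proof (rule inj_onI)
    fix Y Y' assume YY: "Y \<in> ?Y" "Y' \<in> ?Y" "?h Y = ?h Y'"
    obtain x y where "(x, y) \<in> codes_in k U" "Y = digit_value m y" using YY(1) by auto
    moreover obtain x' y' where "(x', y') \<in> codes_in k U" "Y' = digit_value m y'" using YY(2) by auto
    ultimately have "(Y + (m - 1 - j0)) div m = (Y' + (m - 1 - j0)) div m"
      using component_rows_same_block [OF U k vacant, of x y x' y'] by simp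
    with YY(3) have "Y + (m - 1 - j0) = Y' + (m - 1 - j0)" by (metis div_mult_mod_eq)
    then show "Y = Y'" by simp
  qed
  moreover have "?h ` ?Y \<subseteq> {..<m - 1}"
  proof
    fix h assume "h \<in> ?h ` ?Y"
    then obtain x y where xy: "(x, y) \<in> codes_in k U" "h = ?h (digit_value m y)" by auto
    have "h \<noteq> m - 1"
    proof
      assume "h = m - 1"
      then have "digit_value m y + (m - 1 - j0) = (digit_value m y + (m - 1 - j0)) div m * m + (m - 1)"
        using xy(2) by (metis div_mult_mod_eq)
      then have "digit_value m y = (digit_value m y + (m - 1 - j0)) div m * m + j0"
        using vacant by simp
      then have "digit_value m y mod m = j0"
        using vacant(2) by (metis mod_less mod_mult_self3)
      moreover have "digit_value m y mod m \<noteq> j0"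
        using xy codes_in_subset by (intro digit_value_mod_not_vacant [OF _ k vacant(1)]) blast
      ultimately show False by simp
    qed
    moreover have "h < m" using xy m_pos by simp
    ultimately show "h \<in> {..<m - 1}" by simp
  qed
  ultimately have "card ?Y \<le> card {..<m - 1}" by (intro card_inj_on_le) auto
  then show ?thesis by simp
qed

lemma Q_set_append_subset:
  assumes "set x' \<subseteq> {0..<n}" "set y' \<subseteq> {0..<m}"
  shows "Q_set n m (x @ x') (y @ y') \<subseteq> Q_set n m x y"
  using digit_value_append_bounds [OF assms(1) n_pos] digit_value_append_bounds [OF assms(2) m_pos]
  unfolding subset_iff mem_Q_set_iff [OF n_pos m_pos] by blast

text \<open>The row index determines an approximate square within its basic rectangle, so a component
  has at most \<open>m - 1\<close> members in each of the at most \<open>M0\<close> rectangles that it meets.\<close>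

lemma card_codes_in_le:
  fixes M0 :: int
  assumes U: "U \<in> components (E_approx n m D k)" and k: "k \<ge> 1"
    and vacant: "row_count D j0 = 0" "j0 < m"
    and M0: "\<forall>V\<in>components (E_tilde n m D k).
           int (card {R \<in> basic_rectangles n m D k. R \<subseteq> V}) \<le> M0"
  shows "int (card (codes_in k U)) \<le> (int m - 1) * M0"
proof -
  let ?Y = "(\<lambda>(x, y). digit_value m y) ` codes_in k U"
  let ?R = "\<lambda>x y. Q_set n m x (take k y)"
  have basic: "?R x y \<in> basic_rectangles n m D k" if "(x, y) \<in> square_codes n m D k" for x y
  proof -
    have len: "length x = k" "length y = ell n m k" and zip: "set (zip x y) \<subseteq> D"
      using that by (auto simp: square_codes_def)
    have "map fst (zip x y) = x" "map snd (zip x y) = take k y"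
      using len k_le_ell [of k] by (simp_all add: map_fst_zip_take map_snd_zip_take)
    then have "?R x y = S_word n m (zip x y) ` ({0..1} \<times> {0..1})"
      by (simp add: S_word_image_unit_square [OF n_pos m_pos])
    moreover have "length (zip x y) = k" using len k_le_ell [of k] by simp
    ultimately show ?thesis using zip unfolding basic_rectangles_def by blast
  qed
  have square_sub: "Q_set n m x y \<subseteq> ?R x y" if "(x, y) \<in> square_codes n m D k" for x y
  proof -
    have "set (drop k y) \<subseteq> {0..<m}"
      using square_codes_set(4) [OF that] set_drop_subset [of k y] by blast
    then show ?thesis using Q_set_append_subset [of "[]" "drop k y" x "take k y"] by simp
  qed
  have "U \<subseteq> E_tilde n m D k"
  proof
    fix p assume "p \<in> U"
    then obtain x y where xy: "(x, y) \<in> codes_in k U" "p \<in> Q_set n m x y"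
      by (rule mem_componentE [OF U])
    then have "(x, y) \<in> square_codes n m D k" using codes_in_subset by blast
    with basic square_sub xy(2) show "p \<in> E_tilde n m D k" unfolding E_tilde_def by blast
  qed
  then obtain V where V: "V \<in> components (E_tilde n m D k)" "U \<subseteq> V"
    using exists_component_superset in_components_connected [OF U] in_components_nonempty [OF U]
    by (metis subset_empty)
  let ?B = "{R \<in> basic_rectangles n m D k. R \<subseteq> V}"
  have "basic_rectangles n m D k = (\<lambda>w. S_word n m w ` ({0..1} \<times> {0..1})) ` digit_words D k"
    by (auto simp: basic_rectangles_def digit_words_def)
  then have finB: "finite ?B" using finite_digit_words [OF finite_D] by simp
  have RV: "?R x y \<in> ?B" if c: "(x, y) \<in> codes_in k U" for x y
  proof -
    have code: "(x, y) \<in> square_codes n m D k" using c codes_in_subset by blast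
    have "Q_set n m x y \<subseteq> V" using c V(2) by (auto simp: codes_in_def)
    then have "?R x y \<inter> V \<noteq> {}" using square_sub [OF code] Q_set_corner [of x y] by blast
    moreover have "?R x y \<subseteq> E_tilde n m D k" using basic [OF code] unfolding E_tilde_def by blast
    ultimately show ?thesis using Q_set_subset_component [OF V(1)] basic [OF code] by blast
  qed
  let ?f = "\<lambda>(x, y). (?R x y, digit_value m y)"
  have "inj_on ?f (codes_in k U)"
  proof (rule inj_onI, clarsimp)
    fix x y x' y'
    assume c: "(x, y) \<in> codes_in k U" "(x', y') \<in> codes_in k U"
      and R: "?R x y = ?R x' y'" and Y: "digit_value m y = digit_value m y'"
    have code: "(x, y) \<in> square_codes n m D k" "(x', y') \<in> square_codes n m D k"
      using c codes_in_subset by blast+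
    then have len: "length x = k" "length x' = k" "length y = length y'"
      by (auto simp: square_codes_def)
    have le: "digit_value n b \<le> digit_value n a"
      if "length a = k" "length b = k" "Q_set n m a s \<subseteq> Q_set n m b t" for a b s t
    proof -
      have "(real (digit_value n a) / real n ^ length a, real (digit_value m s) / real m ^ length s)
          \<in> Q_set n m b t" using Q_set_corner that(3) by blast
      then show ?thesis using that n_pos by (simp add: mem_Q_set_iff [OF n_pos m_pos])
    qed
    have "digit_value n x = digit_value n x'"
      using le [of x x' "take k y" "take k y'"] le [of x' x "take k y'" "take k y"] R len by simp
    then show "x = x' \<and> y = y'"
      using digit_value_inj [of x x' n] digit_value_inj [of y y' m] len Y
        square_codes_set [OF code(1)] square_codes_set [OF code(2)] by simp
  qed
  moreover have "?f ` codes_in k U \<subseteq> ?B \<times> ?Y" using RV by force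
  ultimately have "card (codes_in k U) \<le> card (?B \<times> ?Y)"
    using finB finite_codes_in by (intro card_inj_on_le) auto
  also have "\<dots> = card ?B * card ?Y" by (rule card_cartesian_product)
  finally have "int (card (codes_in k U)) \<le> int (card ?B) * int (card ?Y)"
    by (simp flip: of_nat_mult)
  also have "\<dots> \<le> M0 * (int m - 1)"
  proof (intro mult_mono)
    show B: "int (card ?B) \<le> M0" using M0 V(1) by blast
    show "int (card ?Y) \<le> int m - 1" using card_component_rows_le [OF U k vacant] m_pos by linarith
    show "0 \<le> M0" using B by linarith
  qed simp
  finally show ?thesis by (simp add: mult.commute)
qed

section \<open>Ratios of measures\<close>

text \<open>If the carry takes place before position \<open>k\<close>, only digits \<open>m - 1\<close> and \<open>0\<close> are left and the weights
  agree; otherwise the carry digits \<open>c\<close> and \<open>c + 1\<close> make the whole difference. The trailing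
  digits contribute equally, since doubling makes the two extreme rows equally heavy whenever both
  occur here.\<close>

lemma weight_ratio_after_carry:
  assumes doubling: "doubling_on E \<mu>"
    and w: "length w = length w'" "set w \<subseteq> snd ` D" "set w' \<subseteq> snd ` D"
    and Suc: "digit_value m w' = Suc (digit_value m w)"
  obtains c c' where "c \<in> snd ` D" "c' \<in> snd ` D"
    "row_weight D (drop k w') * row_count D c = row_weight D (drop k w) * row_count D c'"
proof -
  have "set w \<subseteq> {0..<m}" "set w' \<subseteq> {0..<m}" using w D_bounds by force+
  then obtain v c t where v: "w = v @ [c] @ replicate t (m - 1)" "w' = v @ [Suc c] @ replicate t 0"
    using digit_value_Suc_carry [OF w(1) _ _ Suc] by blast
  have c: "c \<in> snd ` D" "Suc c \<in> snd ` D" using v w by auto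
  have ends: "row_count D 0 = row_count D (m - 1)" if "t > 0"
    using doubling_extreme_rows_eq [OF doubling c] that v w by (auto simp: set_replicate_conv_if)
  have rep: "row_count D 0 ^ s = row_count D (m - 1) ^ s" if "s \<le> t" for s
    using ends that by (cases "t > 0") auto
  show thesis
  proof (cases "k \<le> length v")
    case True
    then show thesis using that [OF c] v rep [of t] by simp
  next
    case False
    then obtain i where "k = length v + Suc i" by (metis add_Suc_right not_le less_imp_Suc_add)
    then have "drop k w = replicate (t - i) (m - 1)" "drop k w' = replicate (t - i) 0"
      using v by simp_all
    then show thesis using that [OF c(1) c(1)] rep [of "t - i"] by simp
  qed
qed

lemma weight_ratio_neighbours:
  assumes doubling: "doubling_on E \<mu>"
    and w: "length w = length w'" "set w \<subseteq> snd ` D" "set w' \<subseteq> snd ` D"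
    and near: "digit_value m w' \<le> Suc (digit_value m w)" "digit_value m w \<le> Suc (digit_value m w')"
  obtains c c' where "c \<in> snd ` D" "c' \<in> snd ` D"
    "row_weight D (drop k w') * row_count D c = row_weight D (drop k w) * row_count D c'"
proof -
  consider "digit_value m w' = digit_value m w" | "digit_value m w' = Suc (digit_value m w)"
    | "digit_value m w = Suc (digit_value m w')" using near by linarith
  then show thesis
  proof cases
    case 1
    have "set w \<subseteq> {0..<m}" "set w' \<subseteq> {0..<m}" using w D_bounds by force+
    then have "w = w'" using digit_value_inj [OF w(1)] 1 by simp
    moreover obtain d where "d \<in> D" using card_D_pos by (metis all_not_in_conv card.empty less_irrefl)
    ultimately show thesis using that [of "snd d" "snd d"] by simp
  next
    case 2
    then show thesis using weight_ratio_after_carry [OF doubling w 2] that by metis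
  next
    case 3
    then show thesis using weight_ratio_after_carry [OF doubling w(1) [symmetric] w(3,2) 3] that by metis
  qed
qed

text \<open>The row indices of a component differ by less than \<open>m\<close>, so after removal of the last digit they differ
  by at most one. This is where the four row counts come from: two for the carry, two for the
  last digits.\<close>

lemma weight_ratio_in_component:
  assumes doubling: "doubling_on E \<mu>"
    and U: "U \<in> components (E_approx n m D k)" and k: "k \<ge> 1"
    and vacant: "row_count D j0 = 0" "j0 < m"
    and c1: "(x, y) \<in> codes_in k U" and c2: "(x', y') \<in> codes_in k U"
  obtains c b c' b' where "c \<in> snd ` D" "b \<in> snd ` D" "c' \<in> snd ` D" "b' \<in> snd ` D"
    "row_weight D (drop k y') * (row_count D c * row_count D b)
      = row_weight D (drop k y) * (row_count D c' * row_count D b')"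
proof -
  have code: "(x, y) \<in> square_codes n m D k" "(x', y') \<in> square_codes n m D k"
    using c1 c2 codes_in_subset by blast+
  then have len: "length y = ell n m k" "length y' = ell n m k" by (auto simp: square_codes_def)
  obtain w b where y: "y = w @ [b]" using len(1) k_le_ell [of k] k by (cases y rule: rev_cases) auto
  obtain w' b' where y': "y' = w' @ [b']" using len(2) k_le_ell [of k] k by (cases y' rule: rev_cases) auto
  have w: "length w = length w'" "set w \<subseteq> snd ` D" "set w' \<subseteq> snd ` D"
    and b: "b \<in> snd ` D" "b' \<in> snd ` D"
    using len y y' square_codes_set(2) [OF code(1)] square_codes_set(2) [OF code(2)] by auto
  show thesis
  proof (cases "k \<le> length w")
    case False
    \<comment> \<open>Here \<open>\<ell>(k) = k\<close>, so the weights are empty products.\<close>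
    then have "row_weight D (drop k y') = 1" "row_weight D (drop k y) = 1" using y y' w by simp_all
    then show thesis using that [OF b(1) b(1) b(1) b(1)] by simp
  next
    case True
    let ?h = "\<lambda>y. digit_value m y + (m - 1 - j0)"
    have same: "?h y div m = ?h y' div m"
      by (rule component_rows_same_block [OF U k vacant c1 c2])
    then have "?h y div m * m = ?h y' div m * m" by simp
    then have "?h y < ?h y' + m" "?h y' < ?h y + m"
      using div_times_less_eq_dividend [of "?h y" m] div_times_less_eq_dividend [of "?h y'" m]
        dividend_less_div_times [OF m_pos, of "?h y"] dividend_less_div_times [OF m_pos, of "?h y'"]
      by linarith+
    then have "digit_value m y \<le> digit_value m y' + m" "digit_value m y' \<le> digit_value m y + m" by simp_all
    then have "digit_value m y div m \<le> (digit_value m y' + m) div m"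
      "digit_value m y' div m \<le> (digit_value m y + m) div m" by (simp_all only: div_le_mono)
    moreover have "b < m" "b' < m" using b D_bounds by auto
    ultimately have "digit_value m w \<le> Suc (digit_value m w')" "digit_value m w' \<le> Suc (digit_value m w)"
      using m_pos y y' by simp_all
    then obtain c c' where c: "c \<in> snd ` D" "c' \<in> snd ` D"
      "row_weight D (drop k w') * row_count D c = row_weight D (drop k w) * row_count D c'"
      using weight_ratio_neighbours [OF doubling w] by blast
    have "row_weight D (drop k y') * (row_count D c * row_count D b)
        = (row_weight D (drop k w') * row_count D c) * (row_count D b' * row_count D b)"
      using True y' w by simp
    also have "\<dots> = row_weight D (drop k y) * (row_count D c' * row_count D b')"
      unfolding c(3) using True y by simp
    finally show thesis by (rule that [OF c(1) b(1) c(2) b(2)])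
  qed
qed

lemma row_count_le: "row_count D j \<le> n"
proof -
  have "{i. (i, j) \<in> D} \<subseteq> {0..<n}" using D_bounds by force
  then show ?thesis using card_mono [of "{0..<n}"] unfolding row_count_def by fastforce
qed

lemma row_count_pos: "j \<in> snd ` D \<Longrightarrow> row_count D j > 0"
  using nonvacant_iff [of j] by (auto simp: nonvacant_rows_def)

text \<open>At most \<open>m - 1\<close> values are distinct and non-zero, as one row is vacant; one of them is split off.\<close>

lemma prod_terms_eq_mult:
  assumes vacant: "row_count D j0 = 0" "j0 < m" and c: "c \<in> snd ` D"
  obtains q where "\<Prod>(distinct_nonzero_terms m D) = row_count D c * q" "q > 0" "q \<le> n ^ (m - 2)"
proof -
  let ?S = "distinct_nonzero_terms m D"
  have fin: "finite ?S" by (simp add: distinct_nonzero_terms_def)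
  have mem: "row_count D c \<in> ?S"
    using c row_count_pos [OF c] D_bounds by (auto simp: distinct_nonzero_terms_def)
  have "?S \<subseteq> row_count D ` ({0..<m} - {j0})" using vacant by (auto simp: distinct_nonzero_terms_def)
  then have "card ?S \<le> card (row_count D ` ({0..<m} - {j0}))" by (intro card_mono) auto
  also have "\<dots> \<le> m - 1" using card_image_le [of "{0..<m} - {j0}" "row_count D"] vacant by simp
  finally have card: "card (?S - {row_count D c}) \<le> m - 2" using mem fin by simp
  have bound: "0 < a \<and> a \<le> n" if "a \<in> ?S" for a
    using that row_count_le by (auto simp: distinct_nonzero_terms_def)
  let ?q = "\<Prod>(?S - {row_count D c})"
  have q_pos: "?q > 0" using bound by (intro prod_pos) auto
  have "?q \<le> (\<Prod>a\<in>?S - {row_count D c}. n)" using bound by (intro prod_mono) auto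
  also have "\<dots> = n ^ card (?S - {row_count D c})" by simp
  also have "\<dots> \<le> n ^ (m - 2)" using card n_pos by (intro power_increasing) auto
  finally have "?q \<le> n ^ (m - 2)" .
  moreover have "\<Prod>?S = row_count D c * ?q" using prod.remove [OF fin mem, of "\<lambda>a. a"] by simp
  ultimately show thesis using that q_pos by blast
qed

lemma integral_weight_ratio:
  assumes doubling: "doubling_on E \<mu>"
    and U: "U \<in> components (E_approx n m D k)" and k: "k \<ge> 1"
    and vacant: "row_count D j0 = 0" "j0 < m"
    and c1: "(x, y) \<in> codes_in k U" and c2: "(x', y') \<in> codes_in k U"
  obtains u where "0 < u" "u \<le> n ^ (2 * m - 2)"
    "row_weight D (drop k y') * (\<Prod>(distinct_nonzero_terms m D)) ^ 2 = u * row_weight D (drop k y)"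
proof -
  let ?P = "\<Prod>(distinct_nonzero_terms m D)"
  obtain c b c' b' where cb: "c \<in> snd ` D" "b \<in> snd ` D" "c' \<in> snd ` D" "b' \<in> snd ` D"
    and eq: "row_weight D (drop k y') * (row_count D c * row_count D b)
      = row_weight D (drop k y) * (row_count D c' * row_count D b')"
    using weight_ratio_in_component [OF doubling U k vacant c1 c2] by blast
  obtain q where q: "?P = row_count D c * q" "q > 0" "q \<le> n ^ (m - 2)"
    using prod_terms_eq_mult [OF vacant cb(1)] by blast
  obtain r where r: "?P = row_count D b * r" "r > 0" "r \<le> n ^ (m - 2)"
    using prod_terms_eq_mult [OF vacant cb(2)] by blast
  let ?u = "(row_count D c' * row_count D b') * (q * r)"
  have "?P ^ 2 = (row_count D c * row_count D b) * (q * r)"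
    unfolding power2_eq_square by (subst q(1), subst r(1)) simp
  then have "row_weight D (drop k y') * ?P ^ 2
      = (row_weight D (drop k y') * (row_count D c * row_count D b)) * (q * r)" by (simp only: mult.assoc)
  also have "\<dots> = ?u * row_weight D (drop k y)" unfolding eq by simp
  finally have 1: "row_weight D (drop k y') * ?P ^ 2 = ?u * row_weight D (drop k y)" .
  have 2: "0 < ?u" using row_count_pos [OF cb(3)] row_count_pos [OF cb(4)] q r by simp
  have "?u \<le> (n * n) * (n ^ (m - 2) * n ^ (m - 2))"
    using row_count_le q r by (intro mult_mono) auto
  also have "\<dots> = n ^ (2 + ((m - 2) + (m - 2)))" by (simp add: power_add power2_eq_square)
  also have "2 + ((m - 2) + (m - 2)) = 2 * m - 2" using m_ge_2 by simp
  finally show thesis using that [OF 2 _ 1] by simp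
qed

lemma measure_component:
  assumes "U \<in> components (E_approx n m D k)"
  shows "measure \<mu> U = real (\<Sum>(x, y)\<in>codes_in k U. row_weight D (drop k y)) / real (card D) ^ ell n m k"
  using measure_Union_squares [OF codes_in_subset, of k U] component_eq_Union [OF assms] by simp

lemma weight_pos: "(x, y) \<in> square_codes n m D k \<Longrightarrow> row_weight D (drop k y) > 0"
  using row_weight_pos by (auto simp: square_codes_def)

lemma component_measure_ratio:
  assumes doubling: "doubling_on E \<mu>"
    and U: "U \<in> components (E_approx n m D k)" and k: "k \<ge> 1"
    and vacant: "row_count D j0 = 0" "j0 < m"
    and c: "(x, y) \<in> codes_in k U"
  obtains u where "0 < u" "u \<le> card (codes_in k U) * n ^ (2 * m - 2)"
    "measure \<mu> U * real (\<Prod>(distinct_nonzero_terms m D)) ^ 2 = real u * measure \<mu> (Q_set n m x y)"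
proof -
  let ?P = "\<Prod>(distinct_nonzero_terms m D)" and ?wt = "\<lambda>c. row_weight D (drop k (snd c))"
  have code: "(x, y) \<in> square_codes n m D k" using c codes_in_subset by blast
  have "\<exists>u. 0 < u \<and> u \<le> n ^ (2 * m - 2) \<and> ?wt c' * ?P ^ 2 = u * row_weight D (drop k y)"
    if "c' \<in> codes_in k U" for c'
    using integral_weight_ratio [OF doubling U k vacant c, of "fst c'" "snd c'"] that
    by (metis prod.collapse)
  then obtain u where u: "\<And>c'. c' \<in> codes_in k U \<Longrightarrow> 0 < u c' \<and> u c' \<le> n ^ (2 * m - 2)
      \<and> ?wt c' * ?P ^ 2 = u c' * row_weight D (drop k y)"
    by metis
  let ?u = "sum u (codes_in k U)"
  have "0 < ?u" using u finite_codes_in c by (intro sum_pos) auto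
  moreover have "?u \<le> card (codes_in k U) * n ^ (2 * m - 2)"
    using u sum_bounded_above [of "codes_in k U" u "n ^ (2 * m - 2)"] by simp
  moreover have "sum ?wt (codes_in k U) * ?P ^ 2 = ?u * row_weight D (drop k y)"
    unfolding sum_distrib_right using u by (intro sum.cong) auto
  then have "real (sum ?wt (codes_in k U)) * real ?P ^ 2 = real ?u * real (row_weight D (drop k y))"
    by (metis of_nat_mult of_nat_power)
  then have "measure \<mu> U * real ?P ^ 2 = real ?u * measure \<mu> (Q_set n m x y)"
    by (simp add: measure_component [OF U] measure_square [OF code] case_prod_unfold)
  ultimately show thesis using that by blast
qed

lemma square_code_take:
  assumes "(x, y) \<in> square_codes n m D (Suc k)"
  shows "(take k x, take (ell n m k) y) \<in> square_codes n m D k"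
    "Q_set n m x y \<subseteq> Q_set n m (take k x) (take (ell n m k) y)"
proof -
  have len: "length x = Suc k" "length y = ell n m (Suc k)" and zip: "set (zip x y) \<subseteq> D"
    using assms by (auto simp: square_codes_def)
  have L: "k \<le> ell n m k" "ell n m k \<le> ell n m (Suc k)"
    using k_le_ell ell_le_ell_Suc [OF m_ge_2 m_less_n] by auto
  have "set (zip (take k x) (take (ell n m k) y)) \<subseteq> set (zip x y)"
    by (auto simp: set_zip)
  with zip have "set (zip (take k x) (take (ell n m k) y)) \<subseteq> D" by blast
  moreover have "set (drop k (take (ell n m k) y)) \<subseteq> snd ` D"
    using square_codes_set(2) [OF assms] set_drop_subset set_take_subset by fast
  then have "set (drop k (take (ell n m k) y)) \<subseteq> nonvacant_rows m D" using nonvacant_iff by auto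
  ultimately show "(take k x, take (ell n m k) y) \<in> square_codes n m D k"
    using len L by (simp add: square_codes_def)
  have "set (drop k x) \<subseteq> {0..<n}" "set (drop (ell n m k) y) \<subseteq> {0..<m}"
    using square_codes_set(3,4) [OF assms] set_drop_subset [of k x]
      set_drop_subset [of "ell n m k" y] by blast+
  then show "Q_set n m x y \<subseteq> Q_set n m (take k x) (take (ell n m k) y)"
    using Q_set_append_subset [of "drop k x" "drop (ell n m k) y" "take k x" "take (ell n m k) y"] by simp
qed

text \<open>In passing from rank \<open>k\<close> to rank \<open>k + 1\<close> the row digit \<open>y ! k\<close> becomes tied to a column and leaves the
  weight, while the digits from position \<open>\<ell>(k)\<close> on enter it.\<close>

lemma offspring_square_measure:
  assumes code: "(x, y) \<in> square_codes n m D (Suc k)"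
  obtains c g where "c \<in> snd ` D"
    "measure \<mu> (Q_set n m x y) * (real (row_count D c) * real (card D) ^ (ell n m (Suc k) - ell n m k))
      = real g * measure \<mu> (Q_set n m (take k x) (take (ell n m k) y))"
proof -
  let ?L = "ell n m k" and ?L' = "ell n m (Suc k)"
  have len: "length y = ?L'" using code by (auto simp: square_codes_def)
  have L: "k \<le> ?L" "?L \<le> ?L'" "Suc k \<le> ?L'"
    using k_le_ell ell_le_ell_Suc [OF m_ge_2 m_less_n] by auto
  have c: "y ! k \<in> snd ` D" using square_codes_set(2) [OF code] L len nth_mem [of k y] by auto
  have "y = take ?L y @ drop ?L y" by simp
  then have "drop k y = drop k (take ?L y) @ drop ?L y"
    using L len by (metis drop_append length_take min_absorb2 diff_is_0_eq drop0)
  moreover have "drop k y = y ! k # drop (Suc k) y" using L len by (intro Cons_nth_drop_Suc [symmetric]) simp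
  ultimately have "row_count D (y ! k) * row_weight D (drop (Suc k) y)
      = row_weight D (drop k (take ?L y)) * row_weight D (drop ?L y)"
    by (metis row_weight_simps(2,3))
  then have eq: "real (row_count D (y ! k)) * real (row_weight D (drop (Suc k) y))
      = real (row_weight D (drop k (take ?L y))) * real (row_weight D (drop ?L y))"
    by (metis of_nat_mult)
  have N: "real (card D) ^ ?L' = real (card D) ^ ?L * real (card D) ^ (?L' - ?L)"
    using L by (simp flip: power_add)
  have "measure \<mu> (Q_set n m x y) * (real (row_count D (y ! k)) * real (card D) ^ (?L' - ?L))
      = (real (row_count D (y ! k)) * real (row_weight D (drop (Suc k) y))) / real (card D) ^ ?L"
    using measure_square [OF code] card_D_pos unfolding N by simp
  also have "\<dots> = real (row_weight D (drop ?L y)) * measure \<mu> (Q_set n m (take k x) (take ?L y))"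
    unfolding eq measure_square [OF square_code_take(1) [OF code]] by simp
  finally show thesis using that c by blast
qed

end

theorem lemma6p4:
  fixes n m :: nat and D :: "(nat \<times> nat) set" and E :: "(real \<times> real) set"
    and \<mu> :: "(real \<times> real) measure" and M0 L0 :: int and P :: nat
  assumes "2 \<le> m" and "m < n"
    and "in_Mtvd n m D E \<mu>"
    and "\<forall>k\<ge>1. \<forall>V\<in>components (E_tilde n m D k).
           int (card {R \<in> basic_rectangles n m D k. R \<subseteq> V}) \<le> M0"
    and "L0 = (int m - 1) * M0"
    and "P = \<Prod>(distinct_nonzero_terms m D)"
  shows "(\<forall>k\<ge>1. \<forall>U\<in>components (E_approx n m D k). \<forall>B\<in>members n m D k U.
            \<exists>u::int. 0 < u \<and> u < L0 * int n ^ (2 * m) \<and>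
              measure \<mu> U / measure \<mu> B = real_of_int u / real P ^ 2)
       \<and> (\<exists>H::nat. H > 0 \<and>
            (\<forall>k\<ge>1. \<forall>U\<in>components (E_approx n m D k). \<forall>U'\<in>direct_offspring n m D k U.
              \<exists>z::int. measure \<mu> U' / measure \<mu> U = real_of_int z / real H))"
proof -
  interpret carpet n m D E \<mu>
    using assms(1-3) by unfold_locales (auto simp: in_Mtvd_def)
  have doubling: "doubling_on E \<mu>" using assms(3) by (simp add: in_Mtvd_def)
  obtain j0 where vacant: "row_count D j0 = 0" "j0 < m" using assms(3) by (auto simp: in_Mtvd_def)
  have dvd_P: "row_count D c dvd P" if "c \<in> snd ` D" for c
    using prod_terms_eq_mult [OF vacant that] assms(6) by (metis dvd_triv_left)
  have "P > 0" unfolding assms(6) distinct_nonzero_terms_def by (intro prod_pos) auto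
  have square_pos: "measure \<mu> (Q_set n m x y) > 0" if "(x, y) \<in> square_codes n m D k" for k x y
    using measure_square [OF that] weight_pos [OF that] card_D_pos by simp
  have ratio: "\<exists>u::nat. 0 < u \<and> int u < L0 * int n ^ (2 * m) \<and>
      measure \<mu> U * real P ^ 2 = real u * measure \<mu> (Q_set n m x y)"
    if k: "k \<ge> 1" and U: "U \<in> components (E_approx n m D k)" and c: "(x, y) \<in> codes_in k U" for k U x y
  proof -
    obtain u where u: "0 < u" "u \<le> card (codes_in k U) * n ^ (2 * m - 2)"
        "measure \<mu> U * real P ^ 2 = real u * measure \<mu> (Q_set n m x y)"
      using component_measure_ratio [OF doubling U k vacant c] assms(6) by blast
    have card: "int (card (codes_in k U)) \<le> L0"
      using card_codes_in_le [OF U k vacant] assms(4,5) k by blast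
    have "card (codes_in k U) > 0" using c finite_codes_in by (auto simp: card_gt_0_iff)
    with card have "L0 > 0" by linarith
    have "int u \<le> int (card (codes_in k U)) * int n ^ (2 * m - 2)"
      using u(2) by (metis of_nat_le_iff of_nat_mult of_nat_power)
    also have "\<dots> \<le> L0 * int n ^ (2 * m - 2)" using card by (intro mult_right_mono) auto
    also have "\<dots> < L0 * int n ^ (2 * m)"
      using \<open>L0 > 0\<close> m_ge_2 m_less_n by (intro mult_strict_left_mono power_strict_increasing) auto
    finally show ?thesis using u by blast
  qed
  have part1: "\<exists>u::int. 0 < u \<and> u < L0 * int n ^ (2 * m) \<and>
      measure \<mu> U / measure \<mu> B = real_of_int u / real P ^ 2"
    if k: "k \<ge> 1" and U: "U \<in> components (E_approx n m D k)" and B: "B \<in> members n m D k U" for k U B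
  proof -
    obtain x y where xy: "B = Q_set n m x y" "(x, y) \<in> codes_in k U"
      using B by (auto simp: members_def approx_squares_eq codes_in_def)
    obtain u :: nat where u: "0 < u" "int u < L0 * int n ^ (2 * m)"
        "measure \<mu> U * real P ^ 2 = real u * measure \<mu> (Q_set n m x y)"
      using ratio [OF k U xy(2)] by blast
    have "measure \<mu> B > 0" using xy square_pos codes_in_subset by blast
    then have "measure \<mu> U / measure \<mu> B = real_of_int (int u) / real P ^ 2"
      using u(3) \<open>P > 0\<close> xy(1) by (simp add: field_simps)
    with u show ?thesis by (intro exI [of _ "int u"]) simp
  qed
  \<comment> \<open>The three factors of \<open>H\<close> clear the row count and the power of \<open>N\<close> in the ratio of a square to the
    square containing it, and the bounded integer \<open>u\<close> of part (i), which divides \<open>F!\<close>.\<close>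
  define F where "F = nat (L0 * int n ^ (2 * m))"
  define H where "H = P * card D ^ n * fact F"
  have "H > 0" using \<open>P > 0\<close> card_D_pos by (simp add: H_def)
  have part2: "\<exists>z::int. measure \<mu> U' / measure \<mu> U = real_of_int z / real H"
    if k: "k \<ge> 1" and U: "U \<in> components (E_approx n m D k)"
      and U': "U' \<in> direct_offspring n m D k U" for k U U'
  proof -
    have U'c: "U' \<in> components (E_approx n m D (Suc k))" and sub: "U' \<subseteq> U"
      using U' by (auto simp: direct_offspring_def)
    obtain x y where c': "(x, y) \<in> codes_in (Suc k) U'" using codes_in_nonempty [OF U'c] by auto
    then have code': "(x, y) \<in> square_codes n m D (Suc k)" and Q': "Q_set n m x y \<subseteq> U"
      using sub by (auto simp: codes_in_def)
    let ?x = "take k x" and ?y = "take (ell n m k) y" and ?\<Delta> = "ell n m (Suc k) - ell n m k"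
    have "Q_set n m ?x ?y \<inter> U \<noteq> {}"
      using square_code_take(2) [OF code'] Q' Q_set_corner [of x y] by blast
    then have c: "(?x, ?y) \<in> codes_in k U"
      by (rule square_meeting_component [OF U square_code_take(1) [OF code']])
    obtain u where u: "0 < u" "int u < L0 * int n ^ (2 * m)"
        "measure \<mu> U * real P ^ 2 = real u * measure \<mu> (Q_set n m ?x ?y)"
      using ratio [OF k U c] by blast
    obtain u' where u': "measure \<mu> U' * real P ^ 2 = real u' * measure \<mu> (Q_set n m x y)"
      using ratio [OF _ U'c c'] by auto
    obtain a g where a: "a \<in> snd ` D"
      "measure \<mu> (Q_set n m x y) * (real (row_count D a) * real (card D) ^ ?\<Delta>)
        = real g * measure \<mu> (Q_set n m ?x ?y)"
      using offspring_square_measure [OF code'] by blast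
    let ?q = "measure \<mu> (Q_set n m ?x ?y)"
    have q: "?q > 0" using c square_pos codes_in_subset by blast
    \<comment> \<open>The factor \<open>P\<^sup>2\<close> occurs in both component ratios and cancels, which leaves this denominator.\<close>
    let ?K = "u * row_count D a * card D ^ ?\<Delta>"
    have "?K > 0" using u(1) row_count_pos [OF a(1)] card_D_pos by simp
    have "measure \<mu> U > 0" using u(1,3) q \<open>P > 0\<close>
      by (metis mult_pos_pos of_nat_0_less_iff zero_less_mult_pos2 zero_less_power)
    have "measure \<mu> U' * real ?K * (real P ^ 2 * ?q) = (measure \<mu> U' * real P ^ 2) * real ?K * ?q"
      by simp
    also have "\<dots> = real u' * (measure \<mu> (Q_set n m x y) * (real (row_count D a) * real (card D) ^ ?\<Delta>)) * (real u * ?q)"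
      unfolding u' by simp
    also have "\<dots> = real (u' * g) * measure \<mu> U * (real P ^ 2 * ?q)"
      unfolding a(2) u(3) [symmetric] by simp
    finally have "measure \<mu> U' * real ?K = real (u' * g) * measure \<mu> U"
      using q \<open>P > 0\<close> by simp
    then have frac: "measure \<mu> U' / measure \<mu> U = real (u' * g) / real ?K"
      using \<open>measure \<mu> U > 0\<close> \<open>?K > 0\<close> by (simp only: frac_eq_eq of_nat_0_less_iff less_imp_neq [symmetric] not_False_eq_True)
    have "u dvd fact F"
      using u(1,2) by (intro dvd_fact) (auto simp: F_def)
    moreover have "card D ^ ?\<Delta> dvd card D ^ n"
      using ell_Suc_le [OF m_ge_2 m_less_n, of k] by (intro le_imp_power_dvd) simp
    ultimately have "?K dvd fact F * P * card D ^ n"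
      using dvd_P [OF a(1)] by (intro mult_dvd_mono)
    then obtain h where h: "H = ?K * h" unfolding H_def by (metis dvd_def mult.assoc mult.commute)
    then have "h > 0" using \<open>H > 0\<close> by (cases h) auto
    then have "measure \<mu> U' / measure \<mu> U = real_of_int (int (u' * g * h)) / real H"
      unfolding frac h by simp
    then show ?thesis by blast
  qed
  show ?thesis using part1 part2 \<open>H > 0\<close> by blast
qed

end
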